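(* Fix an integer $n\ge 2$. For integers $a_1<a_2<\cdots<a_n$ let $\chi(x)=(x-a_1)\cdots(x-a_n)$, $R=\mathbb{Z}[x]/(\chi(x))$ and $\Delta=\prod_{1\le i<j\le n}(a_j-a_i)$. Then $$\liminf_{\Delta\to \infty} \frac{|\mathrm{Cl}(R)| \cdot 2^{n-1}}{\varphi(\Delta)} = \begin{cases} 1, & \text{if } n=2; \\ 0, & \text{if } n\geq 3,\end{cases}$$ and $$\limsup_{\Delta\to \infty} \frac{|\mathrm{Cl}(R)| \cdot 2^{n-1}}{\varphi(\Delta)} = \prod_{\substack{p \le n - 2 \\ p \text{ prime}}} (1 - p^{-1})^{n - 1 - p}.$$
   Context: Put $K=\mathbb{Q}\otimes_{\mathbb{Z}}R\cong\mathbb{Q}[x]/(\chi(x))$. A fractional $R$-ideal is an $R$-submodule $I\subset K$ that is a free $\mathbb{Z}$-module of rank $n$. Fractional ideals are multiplied in the usual way. Two fractional $R$-ideals $I,J$ are equivalent if $I=kJ$ for some $k\in K^\times$. The ideal class monoid $\mathrm{ICM}(R)$ is the monoid of equivalence classes of fractional $R$-ideals. A fractional $R$-ideal $I$ is invertible if $IJ=R$ for some fractional $R$-ideal $J$. The ideal class group $\mathrm{Cl}(R)$ is the subgroup of $\mathrm{ICM}(R)$ consisting of classes of invertible fractional $R$-ideals. $\varphi$ is Euler's totient function; an empty product equals $1$. The lower and upper limits are over all integer tuples $a_1<\cdots<a_n$ with $n$ fixed: for a real function $F$ of such tuples, $\liminf_{\Delta\to\infty}F=\lim_{N\to\infty}\inf\{F(a_1,\dots,a_n):\Delta\ge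 N\}$ and $\limsup_{\Delta\to\infty}F=\lim_{N\to\infty}\sup\{F(a_1,\dots,a_n):\Delta\ge N\}$. *)

theory Defs
  imports
    "HOL-Analysis.Analysis"
    "HOL-Computational_Algebra.Polynomial"
    "HOL-Number_Theory.Totient"
    "HOL-Algebra.Algebra"
    "HOL-Algebra.Free_Abelian_Groups"
    "HOL-Algebra.Algebraic_Closure_Type"
begin

hide_const (open) Divisibility.prime Polynomials.degree Polynomials.lead_coeff

definition int_tuples :: "nat \<Rightarrow> int list set" where
  "int_tuples n = {as. length as = n \<and> sorted_wrt (<) as}"

definition chi :: "int list \<Rightarrow> 'a::comm_ring_1 poly" where
  "chi as = (\<Prod>i<length as. [:- of_int (as ! i), 1:])"

definition Delta :: "int list \<Rightarrow> int" where
  "Delta as = (\<Prod>(i, j)\<in>{(i, j). i < j \<and> j < length as}. as ! j - as ! i)"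

definition K_ring :: "int list \<Rightarrow> rat poly set ring" where
  "K_ring as = ring_of_type_algebra Quot (PIdl\<^bsub>ring_of_type_algebra\<^esub> (chi as))"

definition R_ring :: "int list \<Rightarrow> int poly set ring" where
  "R_ring as = ring_of_type_algebra Quot (PIdl\<^bsub>ring_of_type_algebra\<^esub> (chi as))"

definition K_class :: "int list \<Rightarrow> rat poly \<Rightarrow> rat poly set" where
  "K_class as f = (PIdl\<^bsub>ring_of_type_algebra\<^esub> (chi as)) +>\<^bsub>ring_of_type_algebra\<^esub> f"

text \<open>The image of \<open>\<int>[x]/(\<chi>)\<close> under the canonical map to \<open>K = \<rat>[x]/(\<chi>)\<close>.  As \<open>\<chi>\<close> is monic,
  this map is injective, see \<open>R_ring_iso\<close> below.\<close>

definition R_in_K :: "int list \<Rightarrow> rat poly set set" where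
  "R_in_K as = range (\<lambda>f :: int poly. K_class as (map_poly of_int f))"

definition fractional_ideal :: "int list \<Rightarrow> rat poly set set \<Rightarrow> bool" where
  "fractional_ideal as I \<longleftrightarrow>
     additive_subgroup I (K_ring as) \<and>
     (\<forall>r\<in>R_in_K as. \<forall>x\<in>I. r \<otimes>\<^bsub>K_ring as\<^esub> x \<in> I) \<and>
     (add_monoid (K_ring as))\<lparr>carrier := I\<rparr> \<cong> free_Abelian_group {..<length as}"

definition ideal_equiv :: "int list \<Rightarrow> (rat poly set set \<times> rat poly set set) set" where
  "ideal_equiv as = {(I, J). fractional_ideal as I \<and> fractional_ideal as J \<and>
     (\<exists>k\<in>Units (K_ring as). I = k <#\<^bsub>K_ring as\<^esub> J)}"

definition ICM :: "int list \<Rightarrow> rat poly set set set set" where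
  "ICM as = {I. fractional_ideal as I} // ideal_equiv as"

text \<open>The library's \<open>ideal_prod\<close> is the additive closure of the set of products, for arbitrary
  subsets of a ring.\<close>

definition invertible_ideal :: "int list \<Rightarrow> rat poly set set \<Rightarrow> bool" where
  "invertible_ideal as I \<longleftrightarrow> fractional_ideal as I \<and>
     (\<exists>J. fractional_ideal as J \<and> I \<cdot>\<^bsub>K_ring as\<^esub> J = R_in_K as)"

definition Cl :: "int list \<Rightarrow> rat poly set set set set" where
  "Cl as = {C \<in> ICM as. \<exists>I\<in>C. invertible_ideal as I}"

text \<open>Since \<^const>\<open>card\<close> is \<open>0\<close> on infinite sets, the cardinality of \<open>Cl(R)\<close> is taken in the
  extended reals.\<close>

definition class_number :: "int list \<Rightarrow> ereal" where
  "class_number as = (if finite (Cl as) then ereal (real (card (Cl as))) else \<infinity>)"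

definition class_ratio :: "int list \<Rightarrow> ereal" where
  "class_ratio as = class_number as * 2 ^ (length as - 1) / ereal (real (totient (nat (Delta as))))"

lemma R_ring_iso: "R_ring as \<simeq> (K_ring as)\<lparr>carrier := R_in_K as\<rparr>"
proof -
  let ?Z = "ring_of_type_algebra :: int poly ring"
  let ?Q = "ring_of_type_algebra :: rat poly ring"
  let ?e = "map_poly (of_int :: int \<Rightarrow> rat)"
  let ?c = "chi as :: int poly"
  let ?P = "PIdl\<^bsub>?Q\<^esub> (chi as)"
  interpret Z: cring ?Z by (rule cring_from_type_algebra)
  interpret Q: cring ?Q by (rule cring_from_type_algebra)
  have P: "?P = {f. chi as dvd f}"
    by (auto simp: cgenideal_def ring_of_type_algebra_def dvd_def mult.commute)
  interpret I: ideal ?P ?Q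
    by (rule Q.cgenideal_ideal) (simp add: ring_of_type_algebra_def)
  have e1: "?e 1 = 1" by (simp add: map_poly_pCons one_pCons)
  have eadd: "?e (f + g) = ?e f + ?e g" for f g
    by (rule poly_eqI) (simp add: coeff_map_poly)
  have emult: "?e (f * g) = ?e f * ?e g" for f g
    by (rule poly_eqI) (simp add: coeff_map_poly coeff_mult)
  have eprod: "?e (\<Prod>i\<in>A. h i) = (\<Prod>i\<in>A. ?e (h i))" for A and h :: "nat \<Rightarrow> int poly"
    by (induction A rule: infinite_finite_induct) (auto simp: e1 emult)
  have echi: "?e ?c = chi as"
    unfolding chi_def eprod by (simp add: map_poly_pCons)
  have edeg: "degree (?e f) = degree f" for f
    by (rule degree_map_poly) auto
  have e0: "?e f = 0 \<longleftrightarrow> f = 0" for f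
    by (auto simp: poly_eq_iff coeff_map_poly)
  have lc: "lead_coeff ?c = 1"
    unfolding chi_def lead_coeff_prod by simp
  have e_dvd: "chi as dvd ?e f \<longleftrightarrow> ?c dvd f" for f
  proof
    assume "?c dvd f"
    then show "chi as dvd ?e f" by (auto simp: dvd_def emult echi)
  next
    assume d: "chi as dvd ?e f"
    obtain q r where qr: "pseudo_divmod f ?c = (q, r)" by fastforce
    have cn: "?c \<noteq> 0" using lc by auto
    have f: "f = ?c * q + r" using pseudo_divmod(1)[OF cn qr] lc by simp
    have r: "r = 0 \<or> degree r < degree ?c" using pseudo_divmod(2)[OF cn qr] .
    have "chi as dvd ?e r"
      using d unfolding f eadd emult echi by (simp add: dvd_add_right_iff)
    with r have "r = 0"
      by (metis dvd_imp_degree_le e0 echi edeg not_le)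
    with f show "?c dvd f" by simp
  qed
  let ?h = "\<lambda>f. K_class as (?e f)"
  have "?e \<in> ring_hom ?Z ?Q"
    by (rule ring_hom_memI) (auto simp: ring_of_type_algebra_def e1 eadd emult)
  from ring_hom_trans[OF this I.rcos_ring_hom]
  have hom: "?h \<in> ring_hom ?Z (K_ring as)"
    by (simp add: K_ring_def K_class_def comp_def)
  interpret h: ring_hom_ring ?Z "K_ring as" ?h
    by (rule ring_hom_ringI2[OF Z.ring_axioms _ hom]) (simp add: K_ring_def I.quotient_is_ring)
  have "K_class as f = ?P \<longleftrightarrow> chi as dvd f" for f
    unfolding K_class_def
    using I.a_rcos_const[of f] I.a_rcos_self[of f] P
    by (auto simp: ring_of_type_algebra_def)
  then have "a_kernel ?Z (K_ring as) ?h = {f. chi as dvd ?e f}"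
    unfolding a_kernel_def' by (simp add: K_ring_def FactRing_def ring_of_type_algebra_def)
  also have "\<dots> = PIdl\<^bsub>?Z\<^esub> ?c"
    unfolding e_dvd by (auto simp: cgenideal_def dvd_def ring_of_type_algebra_def mult.commute)
  finally have "a_kernel ?Z (K_ring as) ?h = PIdl\<^bsub>?Z\<^esub> ?c" .
  moreover have "?h ` carrier ?Z = R_in_K as"
    by (simp add: R_in_K_def ring_of_type_algebra_def)
  ultimately show ?thesis
    using h.FactRing_iso_set_aux unfolding R_ring_def is_ring_iso_def by auto
qed

end

theory Submission
  imports Defs "HOL-Number_Theory.Residues"
begin

text \<open>
  Evaluation at the nodes identifies \<open>K\<close> with \<open>\<rat>\<^sup>n\<close> and \<open>R\<close> with a subring of
  \<open>\<int>\<^sup>n\<close>, the ring of integer vectors that are interpolated by an integer polynomial.  Newton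
  interpolation shows that \<open>R\<close> has index \<open>\<Delta>\<close> in \<open>\<int>\<^sup>n\<close>, and Lagrange interpolation shows that
  \<open>\<Delta>\<int>\<^sup>n \<subseteq> R\<close>.  Below, \<open>\<Delta>\<close> is the constant \<open>vandermonde\<close>, and membership in \<open>R\<close> is the
  predicate \<open>interp\<close>.

  Since \<open>\<int>\<^sup>n\<close> is a principal ideal ring, every invertible ideal can be scaled so that all its
  coordinate projections are \<open>\<int>\<close>.  It then has the form \<open>uR + \<Delta>\<int>\<^sup>n\<close> with all entries of \<open>u\<close> prime
  to \<open>\<Delta>\<close> (lemma \<open>invertible_lattice\<close>), and two such ideals are equivalent if and only if
  \<open>u \<equiv> e v r (mod \<Delta>)\<close> with \<open>r \<in> R\<close> and a vector \<open>e\<close> of signs (lemma \<open>class_ideal_equiv_iff\<close>).  If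
  \<open>a\<^sub>n - a\<^sub>1 > 4\<close>, the only sign vectors in \<open>R\<close> are \<open>1\<close> and \<open>-1\<close>.  Hence the number of classes times
  \<open>2\<^sup>n\<^sup>-\<^sup>1\<close> times the number of units of \<open>R/\<Delta>\<int>\<^sup>n\<close> is \<open>\<phi>(\<Delta>)\<^sup>n\<close> (lemma \<open>card_Cl\<close>).

  The maximal ideals of \<open>R\<close> above a prime \<open>p\<close> correspond to the residue classes of the nodes modulo
  \<open>p\<close>.  If \<open>r(p)\<close> is their number, a proportion \<open>\<Prod> (1 - 1/p)\<^sup>r\<^sup>(\<^sup>p\<^sup>)\<close> of \<open>R/\<Delta>\<int>\<^sup>n\<close> consists of units
  (lemma \<open>card_units_box\<close>), where \<open>p\<close> runs through the primes that divide \<open>\<Delta>\<close>.  For all large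
  \<open>\<Delta>\<close> the ratio in question therefore equals the product of the \<open>(1 - 1/p)\<close> to the power
  \<open>n - 1 - r(p)\<close> (theorem \<open>class_ratio_eq\<close>).

  From here on the problem is about finite sets of integers.  As \<open>r(p) \<le> p\<close>, and as every prime below
  \<open>n\<close> divides \<open>\<Delta>\<close>, the product is at most the constant in the theorem; the nodes
  \<open>0, 1, ..., n - 2, M\<close> attain it.  If \<open>n = 2\<close>, all exponents vanish.  If \<open>n \<ge> 3\<close>, the nodes
  \<open>0, k!, 2 k!, ..., (n - 1) k!\<close> have \<open>r(p) = 1\<close> for all primes \<open>p \<le> k\<close>, and the product is at most
  \<open>\<phi>(k!)/k!\<close>, which tends to zero with the reciprocals of the harmonic numbers.
\<close>

section \<open>Interpolable integer vectors\<close>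

locale nodes =
  fixes a :: "nat \<Rightarrow> int" and n :: nat
  assumes less: "i < j \<Longrightarrow> j < n \<Longrightarrow> a i < a j"
begin

text \<open>Entries at indices from \<open>n\<close> on are ignored, so that vectors can be combined as plain functions.\<close>

definition interp :: "(nat \<Rightarrow> int) \<Rightarrow> bool" where
  "interp x \<longleftrightarrow> (\<exists>f :: int poly. \<forall>i<n. x i = poly f (a i))"

definition vandermonde :: int where
  "vandermonde = (\<Prod>(i, j)\<in>{(i, j). i < j \<and> j < n}. a j - a i)"

lemma node_neq: "i < n \<Longrightarrow> j < n \<Longrightarrow> i \<noteq> j \<Longrightarrow> a i \<noteq> a j"
  using less[of i j] less[of j i] by (metis less_irrefl nat_neq_iff)

lemma interpI: "(\<And>i. i < n \<Longrightarrow> x i = poly f (a i)) \<Longrightarrow> interp x"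
  by (auto simp: interp_def)

lemma interp_cong: "interp x \<Longrightarrow> (\<And>i. i < n \<Longrightarrow> x i = y i) \<Longrightarrow> interp y"
  by (auto simp: interp_def)

lemma interp_const: "interp (\<lambda>_. c)"
  by (rule interpI[of _ "[:c:]"]) simp

lemma interp_add: "interp x \<Longrightarrow> interp y \<Longrightarrow> interp (\<lambda>i. x i + y i)"
  unfolding interp_def by (metis poly_add)

lemma interp_mult: "interp x \<Longrightarrow> interp y \<Longrightarrow> interp (\<lambda>i. x i * y i)"
  unfolding interp_def by (metis poly_mult)

lemma interp_power: "interp x \<Longrightarrow> interp (\<lambda>i. x i ^ k)"
  by (induction k) (auto intro: interp_const interp_mult)

lemma interp_sum: "(\<And>s. s \<in> S \<Longrightarrow> interp (x s)) \<Longrightarrow> interp (\<lambda>i. \<Sum>s\<in>S. x s i)"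
  by (induction S rule: infinite_finite_induct) (auto intro: interp_const interp_add)

lemma poly_diff_dvd: "(b - c :: int) dvd poly f b - poly f c"
proof (induction f)
  case (pCons k f)
  have "poly (pCons k f) b - poly (pCons k f) c = b * (poly f b - poly f c) + (b - c) * poly f c"
    by (simp add: algebra_simps)
  with pCons show ?case by (metis dvd_add dvd_mult dvd_triv_left)
qed simp

lemma interp_dvd_diff: "interp x \<Longrightarrow> i < n \<Longrightarrow> j < n \<Longrightarrow> a i - a j dvd x i - x j"
  by (auto simp: interp_def poly_diff_dvd)

lemma interp_mod_eq:
  assumes "interp x" "i < n" "j < n" "a i mod p = a j mod p"
  shows "p dvd x i \<longleftrightarrow> p dvd x j"
proof -
  have "p dvd a i - a j" using assms(4) by (simp add: mod_eq_dvd_iff)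
  also have "\<dots> dvd x i - x j" using interp_dvd_diff[OF assms(1-3)] .
  finally show ?thesis by (metis dvd_diff_commute dvd_add_right_iff diff_add_cancel)
qed

lemma finite_pairs: "finite {(i, j). i < j \<and> j < (k :: nat)}"
  by (rule finite_subset[of _ "{..<k} \<times> {..<k}"]) auto

lemma vandermonde_pos: "vandermonde > 0"
  unfolding vandermonde_def by (rule prod_pos) (auto simp: less)

text \<open>Up to sign, the factors on the left are those factors of the Vandermonde product that involve the
  index \<open>i\<close>.\<close>

lemma row_dvd_vandermonde:
  assumes "i < n" shows "(\<Prod>j\<in>{..<n} - {i}. a i - a j) dvd vandermonde"
proof -
  let ?g = "\<lambda>j. (min i j, max i j)"
  have "(\<Prod>j\<in>{..<n} - {i}. \<bar>a i - a j\<bar>) = (\<Prod>(i, j)\<in>?g ` ({..<n} - {i}). a j - a i)"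
  proof (subst prod.reindex)
    show "inj_on ?g ({..<n} - {i})"
      by (auto simp: inj_on_def min_def max_def split: if_splits)
    show "(\<Prod>j\<in>{..<n} - {i}. \<bar>a i - a j\<bar>) = prod ((\<lambda>(i, j). a j - a i) \<circ> ?g) ({..<n} - {i})"
    proof (rule prod.cong)
      fix j assume j: "j \<in> {..<n} - {i}"
      then consider "i < j" | "j < i" by fastforce
      then show "\<bar>a i - a j\<bar> = ((\<lambda>(i, j). a j - a i) \<circ> ?g) j"
        using less[of i j] less[of j i] j assms by cases auto
    qed simp
  qed
  also have "\<dots> dvd vandermonde" unfolding vandermonde_def
    by (rule prod_dvd_prod_subset) (use assms in \<open>auto simp: finite_pairs min_def max_def\<close>)
  finally show ?thesis by (simp add: abs_prod[symmetric])
qed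

lemma column_dvd_vandermonde:
  assumes "k < n" shows "(\<Prod>j<k. a k - a j) dvd vandermonde"
proof -
  have "(\<Prod>j<k. a k - a j) dvd (\<Prod>j\<in>{..<n} - {k}. a k - a j)"
    by (rule prod_dvd_prod_subset) (use assms in auto)
  then show ?thesis using row_dvd_vandermonde[OF assms] by (rule dvd_trans)
qed

text \<open>The denominators of the Lagrange basis polynomials divide the Vandermonde product, which therefore
  multiplies all of \<open>\<int>\<^sup>n\<close> into the ring of interpolable vectors.\<close>

lemma interp_vandermonde_multiple: "interp (\<lambda>i. vandermonde * w i)"
proof -
  let ?e = "\<lambda>k i. if i = k then vandermonde * w k else 0"
  have "interp (?e k)" if k: "k < n" for k
  proof -
    obtain c where c: "vandermonde = (\<Prod>j\<in>{..<n} - {k}. a k - a j) * c" using row_dvd_vandermonde[OF k] ..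
    show ?thesis
    proof (rule interpI[of _ "[:c * w k:] * (\<Prod>j\<in>{..<n} - {k}. [:- a j, 1:])"])
      fix i assume i: "i < n"
      show "?e k i = poly ([:c * w k:] * (\<Prod>j\<in>{..<n} - {k}. [:- a j, 1:])) (a i)"
      proof (cases "i = k")
        case True then show ?thesis by (simp add: poly_prod c algebra_simps)
      next
        case False
        then have "(\<Prod>j\<in>{..<n} - {k}. a i - a j) = 0" using i by auto
        with False show ?thesis by (simp add: poly_prod)
      qed
    qed
  qed
  then have "interp (\<lambda>i. \<Sum>k<n. ?e k i)" by (intro interp_sum) auto
  then show ?thesis by (rule interp_cong) simp
qed

text \<open>Interpolability can thus be tested on residues modulo the Vandermonde product, so that all
  counting takes place in finite boxes.\<close>

lemma interp_cong_vandermonde: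
  assumes "interp x" "\<And>i. i < n \<Longrightarrow> [y i = x i] (mod vandermonde)"
  shows "interp y"
proof -
  have "\<exists>w. y i = x i + vandermonde * w" if "i < n" for i
    using assms(2)[OF that] by (metis cong_iff_lin cong_sym)
  then obtain w where "\<And>i. i < n \<Longrightarrow> y i = x i + vandermonde * w i" by metis
  with interp_add[OF assms(1) interp_vandermonde_multiple[of w]] show ?thesis
    by (elim interp_cong) simp
qed

lemma interp_mod: "interp x \<Longrightarrow> interp (\<lambda>i. x i mod vandermonde)"
  by (rule interp_cong_vandermonde) auto

lemma newton_factor:
  fixes f :: "'a::{idom, ring_char_0} poly"
  assumes "k \<le> n" "\<And>i. i < k \<Longrightarrow> poly f (of_int (a i)) = 0"
  shows "(\<Prod>i<k. [:- of_int (a i), 1:]) dvd f"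
  using assms
proof (induction k)
  case (Suc k)
  then obtain q where q: "f = (\<Prod>i<k. [:- of_int (a i), 1:]) * q" by fastforce
  have "poly (\<Prod>i<k. [:- of_int (a i), 1:]) (of_int (a k)) \<noteq> (0 :: 'a)"
    using Suc.prems(1) node_neq[of k] by (force simp: poly_prod)
  moreover have "poly f (of_int (a k)) = 0" using Suc.prems by simp
  ultimately have "poly q (of_int (a k)) = 0" unfolding q by simp
  then have "[:- of_int (a k), 1:] dvd q" by (simp add: poly_eq_0_iff_dvd)
  then have "(\<Prod>i<k. [:- of_int (a i), 1:]) * [:- of_int (a k), 1:] dvd f"
    unfolding q by (intro mult_dvd_mono) auto
  then show ?case by (simp only: prod.lessThan_Suc)
qed simp

lemma card_cong_class:
  fixes m d c :: int
  assumes "m > 0" "d > 0" "d dvd m"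
  shows "int (card {y\<in>{0..<m}. [y = c] (mod d)}) * d = m"
proof -
  obtain q where q: "m = d * q" using assms(3) ..
  have "q > 0" using assms q by (metis zero_less_mult_pos)
  have "bij_betw (\<lambda>t. c mod d + d * t) {0..<q} {y\<in>{0..<m}. [y = c] (mod d)}"
  proof (rule bij_betw_byWitness[where f' = "\<lambda>y. y div d"])
    show "\<forall>t\<in>{0..<q}. (c mod d + d * t) div d = t" using assms(2) by simp
    show "\<forall>y\<in>{y\<in>{0..<m}. [y = c] (mod d)}. c mod d + d * (y div d) = y"
      by (auto simp: cong_def) (metis mod_mult_div_eq)
    show "(\<lambda>t. c mod d + d * t) ` {0..<q} \<subseteq> {y\<in>{0..<m}. [y = c] (mod d)}"
    proof safe
      fix t assume t: "t \<in> {0..<q}"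
      have "d * t \<le> d * (q - 1)" using t assms(2) by (intro mult_left_mono) auto
      moreover have "c mod d < d" "0 \<le> c mod d" using assms(2) by auto
      moreover have "d * t \<ge> 0" using t assms(2) by simp
      ultimately show "c mod d + d * t \<in> {0..<m}" unfolding q by (auto simp: algebra_simps)
      show "[c mod d + d * t = c] (mod d)" by (simp add: cong_def)
    qed
    show "(\<lambda>y. y div d) ` {y\<in>{0..<m}. [y = c] (mod d)} \<subseteq> {0..<q}"
    proof safe
      fix y assume y: "y \<in> {0..<m}"
      have "y div d < q"
      proof (rule ccontr)
        assume "\<not> y div d < q"
        then have "d * q \<le> d * (y div d)" using assms(2) by (intro mult_left_mono) auto
        also have "\<dots> \<le> y" using mult_div_mod_eq[of d y] pos_mod_sign[OF assms(2), of y] by linarith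
        finally show False using y q by simp
      qed
      then show "y div d \<in> {0..<q}" using y assms(2) by (simp add: pos_imp_zdiv_nonneg_iff)
    qed
  qed
  then have "card {y\<in>{0..<m}. [y = c] (mod d)} = nat q"
    using bij_betw_same_card by fastforce
  with \<open>q > 0\<close> show ?thesis by (simp add: q)
qed

text \<open>The elements of the ring modulo the Vandermonde product, with the nodes restricted to the first
  \<open>k\<close> for the sake of induction.\<close>

definition box :: "nat \<Rightarrow> (nat \<Rightarrow> int) set" where
  "box k = {x \<in> {..<k} \<rightarrow>\<^sub>E {0..<vandermonde}. \<exists>f :: int poly. \<forall>i<k. x i = poly f (a i)}"

lemma finite_box: "finite (box k)"
  unfolding box_def by (rule finite_subset[of _ "{..<k} \<rightarrow>\<^sub>E {0..<vandermonde}"]) (auto intro!: finite_PiE)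

text \<open>Newton interpolation: once the values at the first \<open>k\<close> nodes are interpolable, the possible values
  at the next node \<open>a k\<close> form a single residue class modulo \<open>\<Prod>j<k. a k - a j\<close>.\<close>

lemma card_box:
  assumes "k \<le> n"
  shows "int (card (box k)) * (\<Prod>i<k. \<Prod>j<i. a i - a j) = vandermonde ^ k"
  using assms
proof (induction k)
  case 0
  have "box 0 = {\<lambda>_. undefined}" by (auto simp: box_def)
  then show ?case by simp
next
  case (Suc k)
  let ?D = "\<Prod>j<k. a k - a j"
  define next_values where
    "next_values x = {y \<in> {0..<vandermonde}. \<exists>f :: int poly. (\<forall>i<k. x i = poly f (a i)) \<and> y = poly f (a k)}"
    for x :: "nat \<Rightarrow> int"
  have D: "?D > 0" by (rule prod_pos) (use Suc.prems less in auto)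
  have next_card: "int (card (next_values x)) * ?D = vandermonde" if "x \<in> box k" for x
  proof -
    from that obtain f :: "int poly" where f: "\<forall>i<k. x i = poly f (a i)"
      by (auto simp: box_def)
    have "next_values x = {y\<in>{0..<vandermonde}. [y = poly f (a k)] (mod ?D)}"
    proof safe
      fix y assume "y \<in> next_values x"
      then obtain g :: "int poly" where g: "\<forall>i<k. x i = poly g (a i)" "y = poly g (a k)"
        by (auto simp: next_values_def)
      have "(\<Prod>i<k. [:- a i, 1:]) dvd g - f"
        using newton_factor[of k "g - f"] Suc.prems f g by simp
      then obtain q where "g - f = (\<Prod>i<k. [:- a i, 1:]) * q" ..
      then have "poly (g - f) (a k) = ?D * poly q (a k)" by (simp add: poly_prod)
      then show "[y = poly f (a k)] (mod ?D)" by (simp add: g cong_iff_dvd_diff)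
    next
      fix y assume y: "y \<in> {0..<vandermonde}" "[y = poly f (a k)] (mod ?D)"
      then obtain t where t: "y = poly f (a k) + ?D * t" by (metis cong_iff_lin cong_sym)
      let ?g = "f + [:t:] * (\<Prod>i<k. [:- a i, 1:])"
      have "\<forall>i<k. x i = poly ?g (a i)"
        using f by (auto simp: poly_prod)
      moreover have "y = poly ?g (a k)" by (simp add: t poly_prod)
      ultimately show "y \<in> next_values x" using y(1) unfolding next_values_def by blast
    qed (auto simp: next_values_def)
    then show ?thesis
      using card_cong_class[OF vandermonde_pos D column_dvd_vandermonde, of "poly f (a k)"] Suc.prems by simp
  qed
  have "bij_betw (\<lambda>x. (restrict x {..<k}, x k)) (box (Suc k)) (Sigma (box k) next_values)"
  proof (rule bij_betw_byWitness[where f' = "\<lambda>(x, y). x(k := y)"])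
    show "\<forall>x\<in>box (Suc k). (case (restrict x {..<k}, x k) of (x, y) \<Rightarrow> x(k := y)) = x"
      by (auto simp: box_def PiE_def extensional_def fun_eq_iff)
    show "\<forall>z\<in>Sigma (box k) next_values.
        (restrict (case z of (x, y) \<Rightarrow> x(k := y)) {..<k}, (case z of (x, y) \<Rightarrow> x(k := y)) k) = z"
      by (auto simp: box_def PiE_def extensional_def fun_eq_iff)
    show "(\<lambda>x. (restrict x {..<k}, x k)) ` box (Suc k) \<subseteq> Sigma (box k) next_values"
    proof safe
      fix x assume x: "x \<in> box (Suc k)"
      then obtain f :: "int poly" where f: "\<forall>i<Suc k. x i = poly f (a i)" by (auto simp: box_def)
      have range: "x i \<in> {0..<vandermonde}" if "i < Suc k" for i
        using PiE_mem[of x "{..<Suc k}" "\<lambda>_. {0..<vandermonde}" i] x that unfolding box_def by simp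
      have vals: "\<forall>i<k. restrict x {..<k} i = poly f (a i)" "x k = poly f (a k)" using f by auto
      have "restrict x {..<k} \<in> {..<k} \<rightarrow>\<^sub>E {0..<vandermonde}" using range by simp
      with vals show "restrict x {..<k} \<in> box k" unfolding box_def by blast
      show "x k \<in> next_values (restrict x {..<k})"
        using vals range[of k] unfolding next_values_def by blast
    qed
    show "(\<lambda>(x, y). x(k := y)) ` Sigma (box k) next_values \<subseteq> box (Suc k)"
    proof safe
      fix x y assume x: "x \<in> box k" and "y \<in> next_values x"
      then obtain f :: "int poly" where f: "\<forall>i<k. x i = poly f (a i)" "y = poly f (a k)"
        and y: "y \<in> {0..<vandermonde}" by (auto simp: next_values_def)
      have "\<forall>i<Suc k. (x(k := y)) i = poly f (a i)" using f by (auto simp: less_Suc_eq)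
      moreover have "x(k := y) \<in> {..<Suc k} \<rightarrow>\<^sub>E {0..<vandermonde}"
        using x y PiE_fun_upd[of y "\<lambda>_. {0..<vandermonde}" k x "{..<k}"]
        unfolding box_def lessThan_Suc by blast
      ultimately show "x(k := y) \<in> box (Suc k)" unfolding box_def by blast
    qed
  qed
  then have "card (box (Suc k)) = card (Sigma (box k) next_values)" by (rule bij_betw_same_card)
  also have "\<dots> = (\<Sum>x\<in>box k. card (next_values x))"
  proof (rule card_SigmaI)
    show "\<forall>x\<in>box k. finite (next_values x)"
      by (auto simp: next_values_def intro: finite_subset[of _ "{0..<vandermonde}"])
  qed (rule finite_box)
  finally have "int (card (box (Suc k))) * ?D = (\<Sum>x\<in>box k. int (card (next_values x)) * ?D)"
    by (simp add: sum_distrib_right)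
  also have "\<dots> = int (card (box k)) * vandermonde" by (simp add: next_card)
  finally have "int (card (box (Suc k))) * ?D = int (card (box k)) * vandermonde" .
  then have "int (card (box (Suc k))) * (\<Prod>i<Suc k. \<Prod>j<i. a i - a j)
      = vandermonde * (int (card (box k)) * (\<Prod>i<k. \<Prod>j<i. a i - a j))"
    by (simp add: algebra_simps)
  also have "\<dots> = vandermonde ^ Suc k" using Suc by simp
  finally show ?case .
qed

lemma vandermonde_eq: "vandermonde = (\<Prod>i<n. \<Prod>j<i. a i - a j)"
proof -
  have "vandermonde = (\<Prod>(i, j)\<in>Sigma {..<n} (\<lambda>i. {..<i}). a i - a j)"
    unfolding vandermonde_def
    by (rule prod.reindex_bij_witness[of _ prod.swap prod.swap]) auto
  then show ?thesis by (simp add: prod.Sigma)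
qed

lemma card_box_n:
  assumes "n > 0" shows "int (card (box n)) = vandermonde ^ (n - 1)"
proof -
  have "int (card (box n)) * vandermonde = vandermonde ^ n" using card_box[of n] by (simp add: vandermonde_eq)
  also have "\<dots> = vandermonde ^ (n - 1) * vandermonde" using assms by (simp flip: power_Suc2)
  finally show ?thesis using vandermonde_pos by simp
qed

lemma box_iff: "x \<in> box n \<longleftrightarrow> x \<in> {..<n} \<rightarrow>\<^sub>E {0..<vandermonde} \<and> interp x"
  by (auto simp: box_def interp_def)

end

section \<open>Units modulo the Vandermonde product\<close>

context nodes
begin

text \<open>Translation by a multiple of \<open>t\<close> in the finite group \<open>R/\<Delta>\<int>\<^sup>n\<close>, in terms of reduced
  representatives.\<close>

definition shift :: "(nat \<Rightarrow> int) \<Rightarrow> int \<Rightarrow> (nat \<Rightarrow> int) \<Rightarrow> nat \<Rightarrow> int" where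
  "shift t c x = (\<lambda>i\<in>{..<n}. (x i + c * t i) mod vandermonde)"

lemma shift_shift: "shift t c (shift t d x) = shift t (c + d) x"
  by (auto simp: shift_def fun_eq_iff mod_simps algebra_simps)

lemma shift_zero: "x \<in> box n \<Longrightarrow> shift t 0 x = x"
  by (auto simp: shift_def box_iff PiE_def extensional_def fun_eq_iff Pi_def)

lemma shift_in_box:
  assumes "x \<in> box n" "interp t" shows "shift t c x \<in> box n"
proof -
  have "interp (\<lambda>i. (x i + c * t i) mod vandermonde)"
    using assms by (intro interp_mod interp_add interp_mult interp_const) (auto simp: box_iff)
  then show ?thesis
    by (auto simp: box_iff shift_def vandermonde_pos elim!: interp_cong)
qed

lemma shift_mod:
  assumes "p dvd vandermonde" "i < n" shows "shift t c x i mod p = (x i + c * t i) mod p"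
  using assms by (simp add: shift_def mod_mod_cancel)

text \<open>Translation by multiples of \<open>t\<close> permutes \<open>B\<close> and carries the elements with one residue of the
  \<open>i\<close>-th entry modulo \<open>p\<close> to those with any other residue.  So the \<open>p\<close> residues are equally frequent.\<close>

lemma avoid_one_residue:
  fixes p :: nat
  assumes B: "B \<subseteq> box n" "\<And>x c. x \<in> B \<Longrightarrow> shift t c x \<in> B"
    and p: "prime p" "int p dvd vandermonde" and i: "i < n" "\<not> int p dvd t i"
  shows "real (card {x\<in>B. \<not> int p dvd x i}) = real (card B) * (1 - 1 / real p)"
proof -
  have fin: "finite B" using B(1) finite_box finite_subset by blast
  define fib where "fib c = {x\<in>B. x i mod int p = c}" for c
  have "coprime (t i) (int p)" using p i(2) by (metis prime_imp_coprime prime_nat_int_transfer coprime_commute)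
  then obtain s where s: "[t i * s = 1] (mod int p)" using cong_solve_coprime_int by blast
  \<comment> \<open>Since \<open>s\<close> inverts \<open>t i\<close> modulo \<open>p\<close>, translation by \<open>c * s\<close> adds \<open>c\<close> to the residue of the \<open>i\<close>-th entry.\<close>
  have sm: "(c * s * t i) mod int p = c mod int p" for c
  proof -
    have "[c * (t i * s) = c * 1] (mod int p)" using s by (rule cong_scalar_left)
    then show ?thesis by (simp add: cong_def algebra_simps)
  qed
  have "card (fib c) = card (fib 0)" if c: "c \<in> {0..<int p}" for c
  proof -
    have "bij_betw (shift t (c * s)) (fib 0) (fib c)"
    proof (rule bij_betw_byWitness[where f' = "shift t (- (c * s))"])
      show "\<forall>x\<in>fib 0. shift t (- (c * s)) (shift t (c * s) x) = x"
        "\<forall>x\<in>fib c. shift t (c * s) (shift t (- (c * s)) x) = x"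
        using B(1) by (auto simp: shift_shift fib_def shift_zero)
      show "shift t (c * s) ` fib 0 \<subseteq> fib c"
      proof safe
        fix x assume x: "x \<in> fib 0"
        have "(x i + c * s * t i) mod int p = (x i mod int p + c * s * t i mod int p) mod int p"
          by (simp add: mod_simps)
        also have "\<dots> = c" using x c by (simp add: fib_def sm)
        finally show "shift t (c * s) x \<in> fib c" using x B(2) p(2) i(1) by (simp add: fib_def shift_mod)
      qed
      show "shift t (- (c * s)) ` fib c \<subseteq> fib 0"
      proof safe
        fix x assume x: "x \<in> fib c"
        have "(x i + (- (c * s)) * t i) mod int p = (x i mod int p - c * s * t i mod int p) mod int p"
          by (simp add: mod_simps)
        also have "\<dots> = 0" using x c by (simp add: fib_def sm)
        finally show "shift t (- (c * s)) x \<in> fib 0" using x B(2) p(2) i(1)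
          by (simp add: fib_def shift_mod)
      qed
    qed
    then show ?thesis by (rule bij_betw_same_card[symmetric])
  qed
  then have fibs: "(\<Sum>c\<in>{0..<int p}. card (fib c)) = (\<Sum>c\<in>{0..<int p}. card (fib 0))"
    by (rule sum.cong[OF refl])
  have "B = (\<Union>c\<in>{0..<int p}. fib c)"
    using prime_gt_0_nat[OF p(1)] by (auto simp: fib_def)
  then have "card B = card (\<Union>c\<in>{0..<int p}. fib c)" by simp
  also have "\<dots> = (\<Sum>c\<in>{0..<int p}. card (fib c))"
    by (rule card_UN_disjoint) (auto simp: fib_def fin)
  also note fibs
  finally have cB: "card B = p * card (fib 0)" by simp
  have "{x\<in>B. \<not> int p dvd x i} = B - fib 0" by (auto simp: fib_def dvd_eq_mod_eq_0)
  then have "card {x\<in>B. \<not> int p dvd x i} = card B - card (fib 0)"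
    using fin by (simp add: card_Diff_subset fib_def)
  moreover have "card (fib 0) \<le> card B" using fin by (auto intro: card_mono simp: fib_def)
  ultimately have "real (card {x\<in>B. \<not> int p dvd x i}) = real (card B) - real (card (fib 0))"
    by (simp add: of_nat_diff)
  also have "\<dots> = real p * real (card (fib 0)) * (1 - 1 / real p)"
    using prime_gt_0_nat[OF p(1)] by (simp add: cB right_diff_distrib)
  finally show ?thesis by (simp add: cB)
qed

text \<open>The hypotheses on \<open>t\<close> say that the conditions are independent: each of them can be changed by a
  translation that preserves all the others, and therefore contributes its own Euler factor.\<close>

lemma avoid_residues:
  fixes S :: "(nat \<times> nat) set" and t :: "nat \<times> nat \<Rightarrow> nat \<Rightarrow> int"
  assumes "finite S"
    and "\<And>p i. (p, i) \<in> S \<Longrightarrow> prime p \<and> int p dvd vandermonde \<and> i < n \<and> interp (t (p, i)) \<and> \<not> int p dvd t (p, i) i"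
    and "\<And>p i q j. (p, i) \<in> S \<Longrightarrow> (q, j) \<in> S \<Longrightarrow> (p, i) \<noteq> (q, j) \<Longrightarrow> int q dvd t (p, i) j"
  shows "real (card {x\<in>box n. \<forall>(p, i)\<in>S. \<not> int p dvd x i})
      = real (card (box n)) * (\<Prod>(p, i)\<in>S. 1 - 1 / real p)"
  using assms
proof (induction S rule: finite_induct)
  case (insert s S)
  obtain p i where s: "s = (p, i)" by (cases s)
  let ?B = "{x\<in>box n. \<forall>(p, i)\<in>S. \<not> int p dvd x i}"
  have pi: "prime p" "int p dvd vandermonde" "i < n" "interp (t (p, i))" "\<not> int p dvd t (p, i) i"
    using insert.prems(1)[of p i] by (auto simp: s)
  have "real (card {x\<in>?B. \<not> int p dvd x i}) = real (card ?B) * (1 - 1 / real p)"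
  proof (rule avoid_one_residue)
    fix x c assume x: "x \<in> ?B"
    have "\<not> int q dvd shift (t (p, i)) c x j" if qj: "(q, j) \<in> S" for q j
    proof -
      have "int q dvd t (p, i) j" using insert.prems(2)[of p i q j] insert.hyps qj by (auto simp: s)
      then have "(x j + c * t (p, i) j) mod int q = x j mod int q"
        by (metis dvd_mult mod_add_right_eq dvd_imp_mod_0 add.right_neutral)
      moreover have "int q dvd vandermonde" "j < n" "\<not> int q dvd x j"
        using insert.prems(1)[of q j] qj x by auto
      ultimately show ?thesis by (simp only: dvd_eq_mod_eq_0 shift_mod not_False_eq_True)
    qed
    with x show "shift (t (p, i)) c x \<in> ?B" using shift_in_box pi(4) by auto
  qed (use pi in auto)
  also have "{x\<in>?B. \<not> int p dvd x i} = {x\<in>box n. \<forall>(p, i)\<in>insert s S. \<not> int p dvd x i}"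
    by (auto simp: s)
  also have "real (card ?B) = real (card (box n)) * (\<Prod>(p, i)\<in>S. 1 - 1 / real p)"
    by (rule insert.IH) (use insert.prems in auto)
  finally show ?case using insert.hyps by (simp add: s)
qed simp

definition residues_count :: "nat \<Rightarrow> nat" where
  "residues_count p = card ((\<lambda>i. a i mod int p) ` {..<n})"

text \<open>One index for each residue class of the nodes modulo \<open>p\<close>, namely the least one.\<close>

definition firsts :: "nat \<Rightarrow> nat set" where
  "firsts p = {i. i < n \<and> (\<forall>j<i. a j mod int p \<noteq> a i mod int p)}"

lemma first_index:
  assumes "i < n" obtains j where "j \<in> firsts p" "a i mod int p = a j mod int p"
proof -
  let ?P = "\<lambda>j. a j mod int p = a i mod int p"
  let ?l = "LEAST j. ?P j"
  have l: "?P ?l" by (rule LeastI[of ?P i]) simp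
  have "?l \<le> i" by (rule Least_le) simp
  then have "?l \<in> firsts p"
    using assms l unfolding firsts_def by (auto dest: not_less_Least)
  with l show thesis using that by metis
qed

lemma finite_firsts: "finite (firsts p)"
  by (simp add: firsts_def)

lemma firsts_inj:
  assumes "i \<in> firsts p" "j \<in> firsts p" "a i mod int p = a j mod int p" shows "i = j"
  using assms unfolding firsts_def by (metis (mono_tags, lifting) mem_Collect_eq linorder_neqE_nat)

lemma card_firsts: "card (firsts p) = residues_count p"
proof -
  have "inj_on (\<lambda>i. a i mod int p) (firsts p)" by (rule inj_onI) (rule firsts_inj)
  moreover have "(\<lambda>i. a i mod int p) ` firsts p = (\<lambda>i. a i mod int p) ` {..<n}"
  proof
    show "(\<lambda>i. a i mod int p) ` firsts p \<subseteq> (\<lambda>i. a i mod int p) ` {..<n}"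
      by (auto simp: firsts_def)
    show "(\<lambda>i. a i mod int p) ` {..<n} \<subseteq> (\<lambda>i. a i mod int p) ` firsts p"
    proof safe
      fix i assume "i < n"
      then obtain j where "j \<in> firsts p" "a i mod int p = a j mod int p" by (rule first_index)
      then show "a i mod int p \<in> (\<lambda>i. a i mod int p) ` firsts p" by simp
    qed
  qed
  ultimately show ?thesis unfolding residues_count_def by (metis card_image)
qed

definition units_box :: "(nat \<Rightarrow> int) set" where
  "units_box = {x\<in>box n. \<forall>i<n. coprime (x i) vandermonde}"

lemma coprime_vandermonde_iff:
  "coprime x vandermonde \<longleftrightarrow> (\<forall>p\<in>prime_factors (nat vandermonde). \<not> int p dvd x)"
proof
  assume c: "coprime x vandermonde"
  show "\<forall>p\<in>prime_factors (nat vandermonde). \<not> int p dvd x"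
  proof
    fix p assume p: "p \<in> prime_factors (nat vandermonde)"
    then have "int p dvd vandermonde" using vandermonde_pos
      by (metis in_prime_factors_iff int_dvd_int_iff nat_eq_iff less_imp_le)
    moreover have "prime p" using p by auto
    ultimately show "\<not> int p dvd x" using c
      by (metis coprime_common_divisor prime_nat_int_transfer not_prime_unit)
  qed
next
  assume h: "\<forall>p\<in>prime_factors (nat vandermonde). \<not> int p dvd x"
  show "coprime x vandermonde"
  proof (rule ccontr)
    assume "\<not> coprime x vandermonde"
    then have "gcd x vandermonde \<noteq> 1" by (simp add: coprime_iff_gcd_eq_1)
    then obtain p :: nat where p: "prime p" "p dvd nat (gcd x vandermonde)"
      by (metis prime_factor_nat nat_1 int_nat_eq gcd_ge_0_int of_nat_1)
    then have "int p dvd gcd x vandermonde" by (metis gcd_ge_0_int int_dvd_int_iff int_nat_eq)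
    then have "int p dvd x" "int p dvd vandermonde" by auto
    moreover have "p \<in> prime_factors (nat vandermonde)"
      using p(1) \<open>int p dvd vandermonde\<close> vandermonde_pos
      by (metis in_prime_factors_iff int_dvd_int_iff int_nat_eq less_imp_le less_irrefl of_nat_0)
    ultimately show False using h by blast
  qed
qed

text \<open>By \<open>interp_mod_eq\<close>, divisibility of an entry by \<open>p\<close> depends only on the residue class of its
  node, so that being a unit is one condition for each prime \<open>p\<close> and each residue class modulo \<open>p\<close>.
  The Chinese remainder theorem makes these conditions independent.\<close>

lemma card_units_box:
  "real (card units_box)
    = real (card (box n)) * (\<Prod>p\<in>prime_factors (nat vandermonde). (1 - 1 / real p) ^ residues_count p)"
proof -
  let ?P = "prime_factors (nat vandermonde)"
  let ?S = "Sigma ?P firsts"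
  \<comment> \<open>The product of the other primes makes \<open>t (p, i)\<close> vanish modulo them; the other factor vanishes
    modulo \<open>p\<close> at all residue classes except that of \<open>a i\<close>.\<close>
  define t where "t = (\<lambda>(p, i) l. int (\<Prod>q\<in>?P - {p}. q) * (\<Prod>j\<in>firsts p - {i}. a l - a j))"
  have P: "prime p" "int p dvd vandermonde" if "p \<in> ?P" for p
    using that vandermonde_pos by (auto simp: in_prime_factors_iff)
       (metis int_dvd_int_iff int_nat_eq less_imp_le)
  have "units_box = {x\<in>box n. \<forall>(p, i)\<in>?S. \<not> int p dvd x i}"
  proof -
    have "(\<forall>i<n. coprime (x i) vandermonde) \<longleftrightarrow> (\<forall>(p, i)\<in>?S. \<not> int p dvd x i)" if x: "x \<in> box n" for x
    proof
      assume "\<forall>i<n. coprime (x i) vandermonde"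
      then show "\<forall>(p, i)\<in>?S. \<not> int p dvd x i" by (auto simp: coprime_vandermonde_iff firsts_def)
    next
      assume S: "\<forall>(p, i)\<in>?S. \<not> int p dvd x i"
      show "\<forall>i<n. coprime (x i) vandermonde"
      proof (intro allI impI)
        fix i assume i: "i < n"
        show "coprime (x i) vandermonde" unfolding coprime_vandermonde_iff
        proof
          fix p assume p: "p \<in> ?P"
          obtain j where j: "j \<in> firsts p" "a i mod int p = a j mod int p" using first_index[OF i] .
          then have "\<not> int p dvd x j" using S p by auto
          moreover have "j < n" using j(1) by (simp add: firsts_def)
          ultimately show "\<not> int p dvd x i"
            using interp_mod_eq[of x i j "int p"] x i j(2) by (simp add: box_iff)
        qed
      qed
    qed
    then show ?thesis unfolding units_box_def by blast
  qed
  moreover have "real (card {x\<in>box n. \<forall>(p, i)\<in>?S. \<not> int p dvd x i})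
      = real (card (box n)) * (\<Prod>(p, i)\<in>?S. 1 - 1 / real p)"
  proof (rule avoid_residues[where t = t])
    show "finite ?S" by (auto simp: finite_firsts)
  next
    fix p i assume pi: "(p, i) \<in> ?S"
    then have p: "p \<in> ?P" "i \<in> firsts p" by auto
    have "interp (t (p, i))"
      by (rule interpI[of _ "[:int (\<Prod>q\<in>?P - {p}. q):] * (\<Prod>j\<in>firsts p - {i}. [:- a j, 1:])"])
         (simp add: t_def poly_prod)
    moreover have "\<not> int p dvd t (p, i) i"
    proof
      assume "int p dvd t (p, i) i"
      then have "int p dvd int (\<Prod>q\<in>?P - {p}. q) \<or> int p dvd (\<Prod>j\<in>firsts p - {i}. a i - a j)"
        using P(1)[OF p(1)] by (simp add: t_def prime_dvd_mult_iff)
      then show False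
      proof
        assume "int p dvd int (\<Prod>q\<in>?P - {p}. q)"
        then have "p dvd (\<Prod>q\<in>?P - {p}. q)" by (simp only: int_dvd_int_iff)
        then obtain q where "q \<in> ?P - {p}" "p dvd q"
          using P(1)[OF p(1)] by (auto simp: prime_dvd_prod_iff)
        then show False using P(1)[OF p(1)] P(1)[of q] by (auto dest: primes_dvd_imp_eq)
      next
        assume "int p dvd (\<Prod>j\<in>firsts p - {i}. a i - a j)"
        then obtain j where "j \<in> firsts p - {i}" "int p dvd a i - a j"
          using P(1)[OF p(1)] finite_firsts by (auto simp: prime_dvd_prod_iff)
        then show False using firsts_inj[of i p j] p(2) by (auto simp: mod_eq_dvd_iff)
      qed
    qed
    ultimately show "prime p \<and> int p dvd vandermonde \<and> i < n \<and> interp (t (p, i)) \<and> \<not> int p dvd t (p, i) i"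
      using P[OF p(1)] p(2) by (auto simp: firsts_def)
  next
    fix p i q j assume *: "(p, i) \<in> ?S" "(q, j) \<in> ?S" "(p, i) \<noteq> (q, j)"
    show "int q dvd t (p, i) j"
    proof (cases "p = q")
      case True
      then have "(\<Prod>l\<in>firsts p - {i}. a j - a l) = 0"
        using * finite_firsts by auto
      then show ?thesis by (simp add: t_def)
    next
      case False
      then have "q dvd (\<Prod>q\<in>?P - {p}. q)" using *(2) by (intro dvd_prodI) auto
      then have "int q dvd int (\<Prod>q\<in>?P - {p}. q)" by (simp only: int_dvd_int_iff)
      then show ?thesis by (simp add: t_def)
    qed
  qed
  moreover have "(\<Prod>(p, i)\<in>?S. 1 - 1 / real p) = (\<Prod>p\<in>?P. (1 - 1 / real p) ^ residues_count p)"
    by (simp add: prod.Sigma[symmetric] finite_firsts card_firsts)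
  ultimately show ?thesis by simp
qed

end

section \<open>Association of vectors of unit residues\<close>

context nodes
begin

definition residue_units :: "(nat \<Rightarrow> int) set" where
  "residue_units = {..<n} \<rightarrow>\<^sub>E {x \<in> {0..<vandermonde}. coprime x vandermonde}"

text \<open>This turns out to be equality of the ideal classes attached to \<open>u\<close> and \<open>v\<close>; the signs are the units
  of \<open>\<int>\<^sup>n\<close>.\<close>

definition associated :: "(nat \<Rightarrow> int) \<Rightarrow> (nat \<Rightarrow> int) \<Rightarrow> bool" where
  "associated u v \<longleftrightarrow> (\<exists>e r. interp r \<and>
     (\<forall>i<n. e i \<in> {1, - 1} \<and> [u i = e i * v i * r i] (mod vandermonde)))"

lemma card_residue_units:
  assumes "vandermonde > 1" shows "card residue_units = totient (nat vandermonde) ^ n"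
proof -
  have "bij_betw int (totatives (nat vandermonde)) {x \<in> {0..<vandermonde}. coprime x vandermonde}"
  proof (rule bij_betw_byWitness[where f' = nat])
    show "int ` totatives (nat vandermonde) \<subseteq> {x \<in> {0..<vandermonde}. coprime x vandermonde}"
    proof safe
      fix x assume x: "x \<in> totatives (nat vandermonde)"
      have "nat vandermonde > 1" using assms by simp
      with x have "x < nat vandermonde" by (rule totatives_less)
      then show "int x \<in> {0..<vandermonde}" by auto
      have "coprime (int x) (int (nat vandermonde))" using x unfolding coprime_int_iff in_totatives_iff by simp
      then show "coprime (int x) vandermonde" using assms by simp
    qed
    show "nat ` {x \<in> {0..<vandermonde}. coprime x vandermonde} \<subseteq> totatives (nat vandermonde)"
    proof safe
      fix x assume x: "x \<in> {0..<vandermonde}" "coprime x vandermonde"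
      have "x \<noteq> 0" using x(2) assms by auto
      moreover have "coprime (nat x) (nat vandermonde)"
      proof -
        have "coprime (int (nat x)) (int (nat vandermonde))" using x assms by simp
        then show ?thesis by (simp only: coprime_int_iff)
      qed
      ultimately show "nat x \<in> totatives (nat vandermonde)"
        using x(1) nat_mono[of x vandermonde] by (simp add: in_totatives_iff)
    qed
  qed auto
  then have "card (totatives (nat vandermonde)) = card {x \<in> {0..<vandermonde}. coprime x vandermonde}"
    by (rule bij_betw_same_card)
  then have "card {x \<in> {0..<vandermonde}. coprime x vandermonde} = totient (nat vandermonde)"
    by (simp add: totient_def)
  then show ?thesis by (simp add: residue_units_def card_PiE)
qed

lemma coprime_mod_vandermonde: "coprime (x mod vandermonde) vandermonde \<longleftrightarrow> coprime x vandermonde"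
  using vandermonde_pos by (intro coprime_mod_left_iff) simp

lemma finite_residue_units: "finite residue_units"
  unfolding residue_units_def by (rule finite_PiE) (auto intro: finite_subset[of _ "{0..<vandermonde}"])

lemma residue_unitsD:
  assumes "u \<in> residue_units" "i < n"
  shows "coprime (u i) vandermonde" "0 \<le> u i" "u i < vandermonde"
proof -
  have "u i \<in> {x \<in> {0..<vandermonde}. coprime x vandermonde}"
    using assms PiE_mem unfolding residue_units_def by fastforce
  then show "coprime (u i) vandermonde" "0 \<le> u i" "u i < vandermonde" by auto
qed

lemma unit_inverse:
  assumes "coprime x vandermonde" shows "[x * x ^ (totient (nat vandermonde) - 1) = 1] (mod vandermonde)"
proof -
  have "[x ^ totient (nat vandermonde) = 1] (mod vandermonde)"
  proof (cases "vandermonde = 1")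
    case False
    then interpret residues vandermonde "residue_ring vandermonde" using vandermonde_pos by unfold_locales auto
    show ?thesis using assms by (rule euler_theorem)
  qed simp
  moreover have "totient (nat vandermonde) \<noteq> 0" using vandermonde_pos by simp
  ultimately show ?thesis by (simp flip: power_Suc)
qed

lemma cong_cancel:
  assumes "coprime v vandermonde" "[v * x = v * y] (mod vandermonde)" shows "[x = y] (mod vandermonde)"
  using assms by (simp add: cong_mult_lcancel)

lemma associated_coprime:
  assumes "u \<in> residue_units" "i < n" "[u i = e * v * r] (mod vandermonde)"
  shows "coprime r vandermonde"
proof -
  have "coprime (e * v * r) vandermonde"
    using residue_unitsD(1)[OF assms(1,2)] assms(3) cong_imp_coprime by blast
  then show ?thesis by simp
qed

text \<open>The vector \<open>r\<close> is invertible modulo the Vandermonde product, and by Euler's theorem its inverse is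
  one of its powers, hence interpolable.\<close>

lemma associated_inverse:
  assumes u: "u \<in> residue_units" and r: "interp r"
    and eq: "\<And>i. i < n \<Longrightarrow> e i \<in> {1, - 1}" "\<And>i. i < n \<Longrightarrow> [u i = e i * v i * r i] (mod vandermonde)"
  obtains s where "interp s" "\<And>i. i < n \<Longrightarrow> [v i = e i * u i * s i] (mod vandermonde)"
proof
  let ?k = "totient (nat vandermonde) - 1"
  show "interp (\<lambda>i. r i ^ ?k)" by (rule interp_power[OF r])
  fix i assume i: "i < n"
  have "[e i * u i * r i ^ ?k = e i * (e i * v i * r i) * r i ^ ?k] (mod vandermonde)"
    by (intro cong_mult cong_refl eq i)
  also have "e i * (e i * v i * r i) * r i ^ ?k = v i * (r i * r i ^ ?k)"
    using eq(1)[OF i] by auto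
  also have "[\<dots> = v i * 1] (mod vandermonde)"
    by (intro cong_mult cong_refl unit_inverse associated_coprime[OF u i eq(2)[OF i]])
  finally show "[v i = e i * u i * r i ^ ?k] (mod vandermonde)" by (simp add: cong_sym)
qed

text \<open>The difference of two signs is at most \<open>2\<close> in absolute value, but a multiple of the difference of the
  nodes.\<close>

lemma sign_const_far:
  assumes e: "interp e" "\<And>i. i < n \<Longrightarrow> e i \<in> {1, - 1}" and ij: "i < n" "j < n" "a j - a i > 2"
  shows "e i = e j"
proof (rule ccontr)
  assume ne: "e i \<noteq> e j"
  have "a j - a i dvd e j - e i" using interp_dvd_diff[OF e(1)] ij by simp
  moreover have "e j - e i \<noteq> 0" using ne by simp
  ultimately have "\<bar>a j - a i\<bar> \<le> \<bar>e j - e i\<bar>" by (rule dvd_imp_le_int[rotated])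
  moreover have "e i = 1 \<or> e i = - 1" "e j = 1 \<or> e j = - 1"
    using e(2)[OF ij(1)] e(2)[OF ij(2)] by blast+
  then have "\<bar>e j - e i\<bar> \<le> 2" by auto
  ultimately show False using ij(3) by linarith
qed

text \<open>No node is within distance \<open>2\<close> of both extreme nodes, so each sign agrees with one of the extreme
  signs, and these agree with each other.\<close>

lemma sign_const:
  assumes wide: "a (n - 1) - a 0 > 4"
    and e: "interp e" "\<And>i. i < n \<Longrightarrow> e i \<in> {1, - 1}" and i: "i < n"
  shows "e i = e 0"
proof -
  have ends: "e 0 = e (n - 1)" by (rule sign_const_far[OF e]) (use i wide in auto)
  consider "a i - a 0 > 2" | "a (n - 1) - a i > 2" using wide by linarith
  then show ?thesis
  proof cases
    case 1
    have "e 0 = e i" by (rule sign_const_far[OF e]) (use i 1 in auto)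
    then show ?thesis ..
  next
    case 2
    have "e i = e (n - 1)" by (rule sign_const_far[OF e]) (use i 2 in auto)
    with ends show ?thesis by simp
  qed
qed

definition sign :: "nat set \<Rightarrow> nat \<Rightarrow> int" where
  "sign T i = (if i \<in> T then - 1 else 1)"

lemma sign_square: "sign T i * sign T i = 1"
  by (simp add: sign_def)

text \<open>The class of \<open>v\<close> is parametrised by the units \<open>h\<close> of \<open>R/\<Delta>\<int>\<^sup>n\<close> and the sign vectors with first
  entry \<open>1\<close>; the overall sign is absorbed in \<open>h\<close>.  The parametrisation is injective because the
  quotient of two such sign vectors would be an interpolable sign vector, hence constant, hence
  \<open>1\<close>.\<close>

lemma card_associated:
  assumes wide: "a (n - 1) - a 0 > 4" and n: "n > 0" and v: "v \<in> residue_units"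
  shows "card {u\<in>residue_units. associated u v} = card units_box * 2 ^ (n - 1)"
proof -
  let ?F = "\<lambda>(h, T). \<lambda>i\<in>{..<n}. (sign T i * v i * h i) mod vandermonde"
  have inj: "inj_on ?F (units_box \<times> Pow {1..<n})"
  proof (rule inj_onI, clarify)
    fix h T h' T'
    assume h: "h \<in> units_box" "h' \<in> units_box" and T: "T \<subseteq> {1..<n}" "T' \<subseteq> {1..<n}"
      and eq: "(\<lambda>i\<in>{..<n}. (sign T i * v i * h i) mod vandermonde) = (\<lambda>i\<in>{..<n}. (sign T' i * v i * h' i) mod vandermonde)"
    have cong: "[sign T i * h i = sign T' i * h' i] (mod vandermonde)" if i: "i < n" for i
    proof -
      have "(sign T i * v i * h i) mod vandermonde = (sign T' i * v i * h' i) mod vandermonde"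
        using fun_cong[OF eq, of i] i by simp
      then have "[v i * (sign T i * h i) = v i * (sign T' i * h' i)] (mod vandermonde)"
        by (simp add: cong_def mult_ac)
      then show ?thesis by (rule cong_cancel[OF residue_unitsD(1)[OF v i]])
    qed
    let ?k = "totient (nat vandermonde) - 1"
    have hI: "interp h" "interp h'" and hc: "\<And>i. i < n \<Longrightarrow> coprime (h i) vandermonde"
      using h by (auto simp: units_box_def box_iff)
    have "interp (\<lambda>i. sign T i * sign T' i)"
    proof (rule interp_cong_vandermonde)
      show "interp (\<lambda>i. h' i * h i ^ ?k)" by (intro interp_mult interp_power hI)
      fix i assume i: "i < n"
      have "[sign T i * sign T' i * (h i * h i ^ ?k) = sign T i * sign T' i * 1] (mod vandermonde)"
        by (intro cong_mult cong_refl unit_inverse hc i)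
      moreover have "[sign T' i * h i ^ ?k * (sign T i * h i) = sign T' i * h i ^ ?k * (sign T' i * h' i)] (mod vandermonde)"
        by (intro cong_mult cong_refl cong i)
      moreover have "sign T' i * h i ^ ?k * (sign T' i * h' i) = sign T' i * sign T' i * (h' i * h i ^ ?k)"
        "sign T' i * h i ^ ?k * (sign T i * h i) = sign T i * sign T' i * (h i * h i ^ ?k)"
        by (simp_all only: mult_ac)
      ultimately show "[sign T i * sign T' i = h' i * h i ^ ?k] (mod vandermonde)"
        unfolding cong_def by (simp only: sign_square mult_1_left mult_1_right)
    qed
    then have "sign T i * sign T' i = sign T 0 * sign T' 0" if "i < n" for i
      by (rule sign_const[OF wide _ _ that]) (auto simp: sign_def)
    moreover have "sign T 0 * sign T' 0 = 1" using T by (auto simp: sign_def)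
    ultimately have one: "sign T i * sign T' i = 1" if "i < n" for i using that by simp
    have signs: "sign T i = sign T' i" if "i < n" for i
      using one[OF that] by (simp add: sign_def split: if_splits)
    have "i \<in> T \<longleftrightarrow> i \<in> T'" for i
      using signs[of i] T by (cases "i < n") (auto simp: sign_def split: if_splits)
    then have TT: "T = T'" by blast
    have "h i = h' i" if i: "i < n" for i
    proof -
      have "[h i = h' i] (mod vandermonde)"
        by (rule cong_cancel[of "sign T i"]) (use cong[OF i] TT in \<open>auto simp: sign_def\<close>)
      moreover have "h i \<in> {0..<vandermonde}" "h' i \<in> {0..<vandermonde}"
        using h i PiE_mem unfolding units_box_def box_iff by fastforce+
      ultimately show ?thesis by (auto intro: cong_less_imp_eq_int)
    qed
    then have "h = h'" using h by (intro PiE_ext[of h "{..<n}" "\<lambda>_. {0..<vandermonde}" h']) (auto simp: units_box_def box_iff)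
    with TT show "h = h' \<and> T = T'" by simp
  qed
  have "?F ` (units_box \<times> Pow {1..<n}) = {u\<in>residue_units. associated u v}"
  proof safe
    fix h T assume h: "h \<in> units_box" and T: "T \<subseteq> {1..<n}"
    have "coprime (sign T i * v i * h i) vandermonde" if "i < n" for i
      using h residue_unitsD(1)[OF v that] that by (auto simp: units_box_def sign_def)
    then show "(\<lambda>i\<in>{..<n}. (sign T i * v i * h i) mod vandermonde) \<in> residue_units"
      by (auto simp: residue_units_def vandermonde_pos coprime_mod_vandermonde simp del: coprime_mult_left_iff)
    show "associated (\<lambda>i\<in>{..<n}. (sign T i * v i * h i) mod vandermonde) v"
      unfolding associated_def
      by (rule exI[of _ "sign T"], rule exI[of _ h])
         (use h in \<open>auto simp: units_box_def box_iff cong_def sign_def\<close>)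
  next
    fix u assume u: "u \<in> residue_units" and "associated u v"
    then obtain e r where r: "interp r" and
      eq: "\<And>i. i < n \<Longrightarrow> e i \<in> {1, - 1}" "\<And>i. i < n \<Longrightarrow> [u i = e i * v i * r i] (mod vandermonde)"
      by (auto simp: associated_def)
    define T where "T = {i\<in>{1..<n}. e i \<noteq> e 0}"
    define h where "h = (\<lambda>i\<in>{..<n}. (e 0 * r i) mod vandermonde)"
    have e0: "e 0 \<in> {1, - 1}" using eq(1) n by blast
    have sT: "sign T i * e 0 = e i" if "i < n" for i
      using eq(1)[OF that] e0 that by (cases "i = 0") (auto simp: sign_def T_def)
    have rc: "coprime (e 0 * r i) vandermonde" if "i < n" for i
      using associated_coprime[OF u that eq(2)[OF that]] e0 by auto
    have "interp (\<lambda>i. (e 0 * r i) mod vandermonde)" by (intro interp_mod interp_mult interp_const r)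
    then have "interp h" by (rule interp_cong) (simp add: h_def)
    then have "h \<in> units_box" using rc by (auto simp: units_box_def box_iff h_def vandermonde_pos coprime_mod_vandermonde simp del: coprime_mult_left_iff)
    moreover have "u = ?F (h, T)"
    proof (simp, rule extensionalityI)
      show "u \<in> extensional {..<n}" using u by (simp add: residue_units_def PiE_def)
      show "(\<lambda>i\<in>{..<n}. sign T i * v i * h i mod vandermonde) \<in> extensional {..<n}" by simp
      fix i assume "i \<in> {..<n}"
      then have i: "i < n" by simp
      have "(sign T i * v i * h i) mod vandermonde = (sign T i * v i * (e 0 * r i)) mod vandermonde"
        using i by (simp add: h_def mod_mult_right_eq)
      also have "\<dots> = (sign T i * e 0 * v i * r i) mod vandermonde" by (simp only: mult_ac)
      also have "\<dots> = u i mod vandermonde" using eq(2)[OF i] i by (simp add: sT cong_def)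
      finally show "u i = (\<lambda>i\<in>{..<n}. sign T i * v i * h i mod vandermonde) i"
        using residue_unitsD[OF u i] i by simp
    qed
    ultimately show "u \<in> ?F ` (units_box \<times> Pow {1..<n})" by (auto simp: T_def)
  qed
  then have "card {u\<in>residue_units. associated u v} = card (units_box \<times> Pow {1..<n})"
    using card_image[OF inj] by simp
  then show ?thesis by (simp add: card_cartesian_product card_Pow)
qed

text \<open>There are at most \<open>n\<^sup>2\<close> factors in the Vandermonde product, all of them bounded by the distance of
  the extreme nodes.\<close>

lemma wide_if_vandermonde_large:
  assumes "vandermonde > 4 ^ (n * n)" shows "a (n - 1) - a 0 > 4"
proof (rule ccontr)
  assume narrow: "\<not> ?thesis"
  let ?P = "{(i, j). i < j \<and> j < n}"
  have mono: "a i \<le> a j" if "i \<le> j" "j < n" for i j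
    using less[of i j] that by (cases "i = j") auto
  have "vandermonde \<le> (\<Prod>(i, j)\<in>?P. 4)" unfolding vandermonde_def
  proof (rule prod_mono)
    fix z assume "z \<in> ?P"
    then obtain i j where z: "z = (i, j)" "i < j" "j < n" by auto
    have "a 0 \<le> a i" "a j \<le> a (n - 1)" using mono[of 0 i] mono[of j "n - 1"] z by auto
    then show "0 \<le> (case z of (i, j) \<Rightarrow> a j - a i) \<and> (case z of (i, j) \<Rightarrow> a j - a i) \<le> (case z of (i, j) \<Rightarrow> 4)"
      using less[OF z(2,3)] narrow z(1) by auto
  qed
  also have "\<dots> = 4 ^ card ?P" by (simp add: case_prod_unfold)
  also have "card ?P \<le> card ({..<n} \<times> {..<n})" by (rule card_mono) auto
  then have "(4 :: int) ^ card ?P \<le> 4 ^ (n * n)" by (intro power_increasing) (auto simp: card_cartesian_product)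
  finally show False using assms by simp
qed

end

section \<open>Lattices of interpolable vectors\<close>

context nodes
begin

lemma closed_sum:
  fixes L :: "(nat \<Rightarrow> int) set"
  assumes add: "\<And>x y. x \<in> L \<Longrightarrow> y \<in> L \<Longrightarrow> (\<lambda>i. x i + y i) \<in> L"
    and zero: "(\<lambda>_. 0) \<in> L"
    and "\<And>s. s \<in> S \<Longrightarrow> f s \<in> L"
  shows "(\<lambda>i. \<Sum>s\<in>S. f s i) \<in> L"
  using assms(3) by (induction S rule: infinite_finite_induct) (auto intro: zero add)

text \<open>The hypothesis provides, for each prime and each residue class of nodes, an element that is nonzero
  modulo the prime on that class.  Multiplying by polynomials that vanish on the other classes and
  adding up gives an element for the prime; the Chinese remainder theorem combines the primes.\<close>

lemma coprime_element:
  fixes L :: "(nat \<Rightarrow> int) set"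
  assumes add: "\<And>x y. x \<in> L \<Longrightarrow> y \<in> L \<Longrightarrow> (\<lambda>i. x i + y i) \<in> L"
    and zero: "(\<lambda>_. 0) \<in> L"
    and mult: "\<And>r x. interp r \<Longrightarrow> x \<in> L \<Longrightarrow> (\<lambda>i. r i * x i) \<in> L"
    and local: "\<And>p i. prime p \<Longrightarrow> i < n \<Longrightarrow>
      \<exists>x\<in>L. \<exists>y. interp (\<lambda>i. x i * y i) \<and> \<not> int p dvd x i * y i"
  shows "\<exists>u\<in>L. \<forall>i<n. coprime (u i) vandermonde"
proof -
  let ?P = "prime_factors (nat vandermonde)"
  have "\<exists>x\<in>L. \<forall>i<n. \<not> int p dvd x i" if p: "prime p" for p
  proof -
    have "\<forall>j\<in>firsts p. \<exists>x\<in>L. \<exists>y. interp (\<lambda>i. x i * y i) \<and> \<not> int p dvd x j * y j"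
      using local[OF p] by (simp add: firsts_def)
    then obtain x y where x: "\<And>j. j \<in> firsts p \<Longrightarrow> x j \<in> L"
      and xy: "\<And>j. j \<in> firsts p \<Longrightarrow> interp (\<lambda>i. x j i * y j i)"
      and nd: "\<And>j. j \<in> firsts p \<Longrightarrow> \<not> int p dvd x j j * y j j"
      by metis
    \<comment> \<open>Modulo \<open>p\<close>, the vector \<open>f j\<close> is supported on the residue class of \<open>a j\<close>.\<close>
    define f where "f j i = (\<Prod>l\<in>firsts p - {j}. a i - a l)" for j i
    have "interp (f j)" for j
      by (rule interpI[of _ "\<Prod>l\<in>firsts p - {j}. [:- a l, 1:]"]) (simp add: f_def poly_prod)
    then have mem: "(\<lambda>i. \<Sum>j\<in>firsts p. f j i * x j i) \<in> L"
      by (intro closed_sum[OF add zero] mult x)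
    have nondiv: "\<not> int p dvd (\<Sum>j\<in>firsts p. f j i * x j i)" if i: "i < n" for i
    proof -
      obtain k where k: "k \<in> firsts p" "a i mod int p = a k mod int p" using first_index[OF i] .
      have "int p dvd f j i * x j i" if "j \<in> firsts p - {k}" for j
      proof -
        have "int p dvd a i - a k" using k(2) by (simp add: mod_eq_dvd_iff)
        also have "\<dots> dvd f j i" unfolding f_def
          by (rule dvd_prodI) (use k(1) that finite_firsts in auto)
        finally show ?thesis by simp
      qed
      then have rest: "int p dvd (\<Sum>j\<in>firsts p - {k}. f j i * x j i)" by (rule dvd_sum)
      have "\<not> int p dvd f k i"
      proof
        assume "int p dvd f k i"
        then obtain l where l: "l \<in> firsts p - {k}" "int p dvd a i - a l"
          unfolding f_def using p finite_firsts by (auto simp: prime_dvd_prod_iff)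
        then have "a k mod int p = a l mod int p" using k(2) by (simp add: mod_eq_dvd_iff[symmetric])
        then show False using firsts_inj[OF k(1), of l] l(1) by auto
      qed
      moreover have "\<not> int p dvd x k i"
      proof
        assume "int p dvd x k i"
        then have "int p dvd x k i * y k i" by simp
        moreover have "k < n" using k(1) by (simp add: firsts_def)
        ultimately show False using interp_mod_eq[OF xy[OF k(1)] i _ k(2)] nd[OF k(1)] by simp
      qed
      ultimately have "\<not> int p dvd f k i * x k i" using p by (simp add: prime_dvd_mult_iff)
      then show ?thesis using rest k(1) finite_firsts
        by (simp add: sum.remove[of _ k] dvd_add_left_iff)
    qed
    show ?thesis by (rule bexI[OF _ mem]) (intro allI impI nondiv)
  qed
  then have "\<forall>p\<in>?P. \<exists>x\<in>L. \<forall>i<n. \<not> int p dvd x i" by auto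
  then obtain x where x: "\<And>p. p \<in> ?P \<Longrightarrow> x p \<in> L"
    and nd: "\<And>p i. p \<in> ?P \<Longrightarrow> i < n \<Longrightarrow> \<not> int p dvd x p i"
    by metis
  define c where "c p = int (\<Prod>q\<in>?P - {p}. q)" for p
  have "(\<lambda>i. \<Sum>p\<in>?P. c p * x p i) \<in> L"
    by (intro closed_sum[OF add zero] mult x interp_const)
  moreover have "coprime (\<Sum>p\<in>?P. c p * x p i) vandermonde" if i: "i < n" for i
    unfolding coprime_vandermonde_iff
  proof
    fix p assume p: "p \<in> ?P"
    then have pp: "prime p" by auto
    have "int p dvd c q" if "q \<in> ?P - {p}" for q
    proof -
      have "p dvd (\<Prod>q\<in>?P - {q}. q)" by (rule dvd_prodI) (use p that in auto)
      then show ?thesis unfolding c_def by (simp only: int_dvd_int_iff)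
    qed
    then have rest: "int p dvd (\<Sum>q\<in>?P - {p}. c q * x q i)" by (intro dvd_sum dvd_mult2) auto
    have "\<not> int p dvd c p"
    proof
      assume "int p dvd c p"
      then have "p dvd (\<Prod>q\<in>?P - {p}. q)" unfolding c_def by (simp only: int_dvd_int_iff)
      then obtain q where "q \<in> ?P - {p}" "p dvd q" using pp by (auto simp: prime_dvd_prod_iff)
      then show False using pp by (auto dest: primes_dvd_imp_eq)
    qed
    then have "\<not> int p dvd c p * x p i" using nd[OF p i] pp by (simp add: prime_dvd_mult_iff)
    then show "\<not> int p dvd (\<Sum>p\<in>?P. c p * x p i)" using rest p
      by (simp add: sum.remove[of _ p] dvd_add_left_iff)
  qed
  ultimately show ?thesis by (intro bexI[of _ "\<lambda>i. \<Sum>p\<in>?P. c p * x p i"]) auto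
qed

text \<open>A pair of mutually inverse ideals \<open>L\<close> and \<open>M\<close> that both generate \<open>\<int>\<^sup>n\<close>.  Choose \<open>u \<in> L\<close> and
  \<open>v \<in> M\<close> with entries prime to the Vandermonde product \<open>\<Delta>\<close>.  Then \<open>uv\<close> is a unit of \<open>R/\<Delta>\<int>\<^sup>n\<close>,
  and \<open>x = u (uv)\<^sup>-\<^sup>1 (vx)\<close> shows that \<open>L\<close> is generated by \<open>u\<close> modulo \<open>\<Delta>\<int>\<^sup>n\<close>.\<close>

lemma invertible_lattice:
  fixes L M :: "(nat \<Rightarrow> int) set"
  assumes ext: "\<And>x y. x \<in> L \<Longrightarrow> (\<And>i. i < n \<Longrightarrow> x i = y i) \<Longrightarrow> y \<in> L"
    and add: "\<And>x y. x \<in> L \<Longrightarrow> y \<in> L \<Longrightarrow> (\<lambda>i. x i + y i) \<in> L"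
      "\<And>x y. x \<in> M \<Longrightarrow> y \<in> M \<Longrightarrow> (\<lambda>i. x i + y i) \<in> M"
    and zero: "(\<lambda>_. 0) \<in> L" "(\<lambda>_. 0) \<in> M"
    and mult: "\<And>r x. interp r \<Longrightarrow> x \<in> L \<Longrightarrow> (\<lambda>i. r i * x i) \<in> L"
      "\<And>r x. interp r \<Longrightarrow> x \<in> M \<Longrightarrow> (\<lambda>i. r i * x i) \<in> M"
    and proj: "\<And>i. i < n \<Longrightarrow> \<exists>x\<in>L. x i = 1"
    and prod: "\<And>x y. x \<in> L \<Longrightarrow> y \<in> M \<Longrightarrow> interp (\<lambda>i. x i * y i)"
    and local: "\<And>p i. prime p \<Longrightarrow> i < n \<Longrightarrow> \<exists>x\<in>L. \<exists>y\<in>M. \<not> int p dvd x i * y i"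
  shows "\<exists>u\<in>residue_units. \<forall>x. x \<in> L \<longleftrightarrow>
    (\<exists>r w. interp r \<and> (\<forall>i<n. x i = u i * r i + vandermonde * w i))"
proof -
  have "\<exists>u\<in>L. \<forall>i<n. coprime (u i) vandermonde"
  proof (rule coprime_element)
    fix p i assume "prime (p :: nat)" "i < n"
    then obtain x y where "x \<in> L" "y \<in> M" "\<not> int p dvd x i * y i" using local by blast
    then show "\<exists>x\<in>L. \<exists>y. interp (\<lambda>i. x i * y i) \<and> \<not> int p dvd x i * y i"
      using prod[of x y] by auto
  qed (use add zero mult in auto)
  then obtain u where u: "u \<in> L" "\<And>i. i < n \<Longrightarrow> coprime (u i) vandermonde" by blast
  have "\<exists>v\<in>M. \<forall>i<n. coprime (v i) vandermonde"
  proof (rule coprime_element)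
    fix p i assume "prime (p :: nat)" "i < n"
    then obtain x y where "x \<in> L" "y \<in> M" "\<not> int p dvd x i * y i" using local by blast
    then show "\<exists>y\<in>M. \<exists>x. interp (\<lambda>i. y i * x i) \<and> \<not> int p dvd y i * x i"
    proof (intro bexI[of _ y] exI[of _ x] conjI)
      from prod[OF \<open>x \<in> L\<close> \<open>y \<in> M\<close>] show "interp (\<lambda>i. y i * x i)"
        by (rule interp_cong) (rule mult.commute)
      from \<open>\<not> int p dvd x i * y i\<close> show "\<not> int p dvd y i * x i" by (simp add: mult.commute)
    qed
  qed (use add zero mult in auto)
  then obtain v where v: "v \<in> M" "\<And>i. i < n \<Longrightarrow> coprime (v i) vandermonde" by blast
  have conductor: "(\<lambda>i. vandermonde * w i) \<in> L" for w
  proof -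
    have "(\<lambda>i. if i = k then vandermonde * w k else 0) \<in> L" if k: "k < n" for k
    proof -
      obtain x where x: "x \<in> L" "x k = 1" using proj[OF k] by blast
      have "interp (\<lambda>i. vandermonde * (if i = k then w k else 0))" by (rule interp_vandermonde_multiple)
      from mult(1)[OF this x(1)] show ?thesis by (rule ext) (simp add: x(2))
    qed
    then have "(\<lambda>i. \<Sum>k<n. if i = k then vandermonde * w k else 0) \<in> L"
      by (intro closed_sum[OF add(1) zero(1)]) auto
    then show ?thesis by (rule ext) simp
  qed
  let ?k = "totient (nat vandermonde) - 1"
  have main: "x \<in> L \<longleftrightarrow> (\<exists>r w. interp r \<and> (\<forall>i<n. x i = u i * r i + vandermonde * w i))" for x
  proof
    assume x: "x \<in> L"
    \<comment> \<open>The exponent makes the power an inverse of \<open>u * v\<close> modulo the Vandermonde product.\<close>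
    define r where "r i = v i * x i * (u i * v i) ^ ?k" for i
    have uv: "interp (\<lambda>i. u i * v i)" by (rule prod[OF u(1) v(1)])
    have "interp (\<lambda>i. x i * v i * (u i * v i) ^ ?k)"
      by (intro interp_mult[OF prod[OF x v(1)]] interp_power uv)
    then have r: "interp r" by (rule interp_cong) (simp add: r_def mult_ac)
    have "\<exists>w. x i = u i * r i + vandermonde * w" if i: "i < n" for i
    proof -
      have "[x i * (u i * v i * (u i * v i) ^ ?k) = x i * 1] (mod vandermonde)"
        by (intro cong_mult cong_refl unit_inverse) (use u(2) v(2) i in auto)
      moreover have "x i * (u i * v i * (u i * v i) ^ ?k) = u i * r i" by (simp add: r_def mult_ac)
      ultimately have "[u i * r i = x i] (mod vandermonde)" by (simp only: mult_1_right)
      then show ?thesis by (metis cong_iff_lin)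
    qed
    then have "\<exists>w. \<forall>i<n. x i = u i * r i + vandermonde * w i" by metis
    with r show "\<exists>r w. interp r \<and> (\<forall>i<n. x i = u i * r i + vandermonde * w i)" by blast
  next
    assume "\<exists>r w. interp r \<and> (\<forall>i<n. x i = u i * r i + vandermonde * w i)"
    then obtain r w where r: "interp r" and x: "\<And>i. i < n \<Longrightarrow> x i = u i * r i + vandermonde * w i" by blast
    from add(1)[OF mult(1)[OF r u(1)] conductor[of w]] show "x \<in> L"
      by (rule ext) (simp add: x mult.commute)
  qed
  define u' where "u' = (\<lambda>i\<in>{..<n}. u i mod vandermonde)"
  show ?thesis
  proof (intro bexI allI)
    show "u' \<in> residue_units" using u(2) by (auto simp: residue_units_def u'_def vandermonde_pos coprime_mod_vandermonde)
    fix x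
    have "(\<exists>w. \<forall>i<n. x i = u i * r i + vandermonde * w i) \<longleftrightarrow> (\<exists>w. \<forall>i<n. x i = u' i * r i + vandermonde * w i)" for r
    proof
      assume "\<exists>w. \<forall>i<n. x i = u i * r i + vandermonde * w i"
      then obtain w where w: "\<forall>i<n. x i = u i * r i + vandermonde * w i" ..
      have "u i * r i + vandermonde * w i = u' i * r i + vandermonde * (w i + (u i div vandermonde) * r i)" if "i < n" for i
      proof -
        have "u i = u' i + vandermonde * (u i div vandermonde)" using that by (simp add: u'_def)
        moreover have "b = b' + d * q \<Longrightarrow> b * c + d * t = b' * c + d * (t + q * c)" for b b' c d q t :: int
          by (simp add: algebra_simps)
        ultimately show ?thesis by blast
      qed
      with w show "\<exists>w. \<forall>i<n. x i = u' i * r i + vandermonde * w i"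
        by (intro exI[of _ "\<lambda>i. w i + (u i div vandermonde) * r i"]) simp
    next
      assume "\<exists>w. \<forall>i<n. x i = u' i * r i + vandermonde * w i"
      then obtain w where w: "\<forall>i<n. x i = u' i * r i + vandermonde * w i" ..
      have "u' i * r i + vandermonde * w i = u i * r i + vandermonde * (w i - (u i div vandermonde) * r i)" if "i < n" for i
      proof -
        have "u' i = u i - vandermonde * (u i div vandermonde)" using that by (simp add: u'_def minus_mult_div_eq_mod)
        moreover have "(b - d * q) * c + d * t = b * c + d * (t - q * c)" for b c d q t :: int
          by (simp add: algebra_simps)
        ultimately show ?thesis by (simp only:)
      qed
      with w show "\<exists>w. \<forall>i<n. x i = u i * r i + vandermonde * w i"
        by (intro exI[of _ "\<lambda>i. w i - (u i div vandermonde) * r i"]) simp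
    qed
    then show "x \<in> L \<longleftrightarrow> (\<exists>r w. interp r \<and> (\<forall>i<n. x i = u' i * r i + vandermonde * w i))"
      unfolding main by blast
  qed
qed

text \<open>Hermite normal form: the \<open>j\<close>-th basis vector has the least positive \<open>j\<close>-th entry among the elements
  of \<open>L\<close> whose earlier entries vanish.  Together with \<open>triangular_independent\<close> this shows that \<open>L\<close> is a
  free abelian group.\<close>

lemma triangular_basis:
  fixes L :: "(nat \<Rightarrow> int) set" and m :: int
  assumes add: "\<And>x y. x \<in> L \<Longrightarrow> y \<in> L \<Longrightarrow> (\<lambda>i. x i + y i) \<in> L"
    and scale: "\<And>c x. x \<in> L \<Longrightarrow> (\<lambda>i. c * x i) \<in> L"
    and m: "m > 0" "\<And>w. (\<lambda>i. m * w i) \<in> L"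
  shows "\<exists>b. (\<forall>j. b j \<in> L) \<and> (\<forall>j. \<forall>i<j. b j i = 0) \<and> (\<forall>j. b j j \<noteq> 0) \<and>
    (\<forall>x\<in>L. \<forall>k. \<exists>c. \<forall>i<k. x i = (\<Sum>j<k. c j * b j i))"
proof -
  have "\<exists>y\<in>L. (\<forall>i<j. y i = 0) \<and> y j > 0 \<and> (\<forall>x\<in>L. (\<forall>i<j. x i = 0) \<longrightarrow> y j dvd x j)" for j
  proof -
    let ?Q = "\<lambda>d. d > 0 \<and> (\<exists>y\<in>L. (\<forall>i<j. y i = 0) \<and> y j = int d)"
    have "?Q (nat m)"
      using m(1) by (auto intro!: bexI[OF _ m(2)[of "\<lambda>i. if i = j then 1 else 0"]])
    then have Q: "?Q (LEAST d. ?Q d)" by (rule LeastI)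
    then obtain y where y: "y \<in> L" "\<forall>i<j. y i = 0" "y j = int (LEAST d. ?Q d)" by blast
    have "y j dvd x j" if x: "x \<in> L" "\<forall>i<j. x i = 0" for x
    proof (rule ccontr)
      assume nd: "\<not> y j dvd x j"
      have pos: "y j > 0" using y(3) Q by simp
      let ?z = "\<lambda>i. x i + (- (x j div y j)) * y i"
      have "?z \<in> L" by (intro add scale x y)
      moreover have zj: "?z j = x j mod y j" by (simp add: minus_div_mult_eq_mod)
      moreover have "0 < x j mod y j" "x j mod y j < y j"
        using nd pos by (auto simp: dvd_eq_mod_eq_0 order.not_eq_order_implies_strict)
      ultimately have "?Q (nat (x j mod y j))" using x(2) y(2) by (auto intro!: bexI[of _ ?z])
      then have "(LEAST d. ?Q d) \<le> nat (x j mod y j)" by (rule Least_le)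
      then show False using \<open>x j mod y j < y j\<close> \<open>0 < x j mod y j\<close> y(3) by linarith
    qed
    then show ?thesis using y Q by auto
  qed
  then obtain b where b: "\<And>j. b j \<in> L" "\<And>i j. i < j \<Longrightarrow> b j i = 0" "\<And>j. b j j > 0"
    "\<And>j x. x \<in> L \<Longrightarrow> \<forall>i<j. x i = 0 \<Longrightarrow> b j j dvd x j"
    by metis
  have "\<exists>c. (\<forall>i<k. x i = (\<Sum>j<k. c j * b j i)) \<and> (\<lambda>i. x i - (\<Sum>j<k. c j * b j i)) \<in> L"
    if x: "x \<in> L" for x k
  proof (induction k)
    case 0 then show ?case using x by simp
  next
    case (Suc k)
    then obtain c where c: "\<forall>i<k. x i = (\<Sum>j<k. c j * b j i)" "(\<lambda>i. x i - (\<Sum>j<k. c j * b j i)) \<in> L"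
      by blast
    have "b k k dvd x k - (\<Sum>j<k. c j * b j k)" using b(4)[OF c(2), of k] c(1) by simp
    then obtain q where q: "x k - (\<Sum>j<k. c j * b j k) = b k k * q" ..
    define c' where "c' = c(k := q)"
    have c': "(\<Sum>j<Suc k. c' j * b j i) = (\<Sum>j<k. c j * b j i) + q * b k i" for i
      by (simp add: c'_def)
    have "x i = (\<Sum>j<Suc k. c' j * b j i)" if "i < Suc k" for i
    proof (cases "i = k")
      case True then show ?thesis using q unfolding c' by (simp add: algebra_simps)
    next
      case False then show ?thesis using c(1) b(2)[of i k] that unfolding c' by simp
    qed
    moreover have "(\<lambda>i. (x i - (\<Sum>j<k. c j * b j i)) + (- q) * b k i) \<in> L"
      by (intro add scale c b)
    then have "(\<lambda>i. x i - (\<Sum>j<Suc k. c' j * b j i)) \<in> L"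
      unfolding c' by (simp add: algebra_simps)
    ultimately show ?case by blast
  qed
  then have expansion: "\<exists>c. \<forall>i<k. x i = (\<Sum>j<k. c j * b j i)" if "x \<in> L" for x k
    using that by blast
  have "b j j \<noteq> 0" for j using b(3)[of j] by simp
  with b(1,2) expansion show ?thesis by (intro exI[of _ b]) auto
qed

lemma triangular_independent:
  fixes b :: "nat \<Rightarrow> nat \<Rightarrow> int"
  assumes b: "\<And>i j. i < j \<Longrightarrow> b j i = 0" "\<And>j. b j j \<noteq> 0"
    and c: "\<And>i. i < k \<Longrightarrow> (\<Sum>j<k. c j * b j i) = 0" and "i < k"
  shows "c i = 0"
  using \<open>i < k\<close>
proof (induction i rule: less_induct)
  case (less i)
  have "(\<Sum>j<k. c j * b j i) = (\<Sum>j\<in>{i}. c j * b j i)"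
  proof (rule sum.mono_neutral_right)
    show "\<forall>j\<in>{..<k} - {i}. c j * b j i = 0"
    proof
      fix j assume "j \<in> {..<k} - {i}"
      then consider "j < i" | "i < j" by fastforce
      then show "c j * b j i = 0" using less b(1)[of i j] by cases auto
    qed
  qed (use less.prems in auto)
  then show ?case using c[OF less.prems] b(2) by simp
qed

end

section \<open>Coordinates on the algebra of residue classes of polynomials\<close>

locale node_list =
  fixes as :: "int list"
  assumes sorted: "sorted_wrt (<) as"
begin

sublocale nodes "\<lambda>i. as ! i" "length as"
  by unfold_locales (use sorted sorted_wrt_nth_less in blast)

abbreviation K where "K \<equiv> K_ring as"

abbreviation node :: "nat \<Rightarrow> rat" where "node i \<equiv> of_int (as ! i)"

lemma PIdl_chi: "PIdl\<^bsub>ring_of_type_algebra\<^esub> (chi as :: rat poly) = {f. chi as dvd f}"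
  by (auto simp: cgenideal_def ring_of_type_algebra_def dvd_def mult.commute)

lemma ideal_chi: "ideal {f :: rat poly. chi as dvd f} ring_of_type_algebra"
  using cring.cgenideal_ideal[OF cring_from_type_algebra, of "chi as :: rat poly"]
  by (simp add: PIdl_chi) (simp add: ring_of_type_algebra_def)

sublocale K: cring K
  using ideal.quotient_is_cring[OF ideal_chi cring_from_type_algebra]
  by (simp add: K_ring_def PIdl_chi)

lemma K_class_hom: "K_class as \<in> ring_hom ring_of_type_algebra K"
  using ideal.rcos_ring_hom[OF ideal_chi]
  by (simp add: K_ring_def K_class_def[abs_def] PIdl_chi)

lemma carrier_K: "carrier K = range (K_class as)"
  by (auto simp: K_ring_def FactRing_def A_RCOSETS_def' K_class_def ring_of_type_algebra_def)

lemma K_class_in_K [simp]: "K_class as f \<in> carrier K"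
  by (simp add: carrier_K)

lemma K_class_mult: "K_class as f \<otimes>\<^bsub>K\<^esub> K_class as g = K_class as (f * g)"
  using ring_hom_mult[OF K_class_hom, of f g] by (simp add: ring_of_type_algebra_def)

lemma K_class_add: "K_class as f \<oplus>\<^bsub>K\<^esub> K_class as g = K_class as (f + g)"
  using ring_hom_add[OF K_class_hom, of f g] by (simp add: ring_of_type_algebra_def)

lemma K_class_one: "\<one>\<^bsub>K\<^esub> = K_class as 1"
  using ring_hom_one[OF K_class_hom] by (simp add: ring_of_type_algebra_def)

lemma chi_dvd_iff: "chi as dvd (f :: rat poly) \<longleftrightarrow> (\<forall>i<length as. poly f (node i) = 0)"
proof
  assume "chi as dvd f"
  then obtain g where "f = chi as * g" ..
  moreover have "poly (chi as) (node i) = 0" if "i < length as" for i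
    using that unfolding chi_def by (auto simp: poly_prod)
  ultimately show "\<forall>i<length as. poly f (node i) = 0" by simp
next
  assume "\<forall>i<length as. poly f (node i) = 0"
  then show "chi as dvd f"
    using newton_factor[of "length as" f] by (simp add: chi_def)
qed

lemma K_class_eq_iff:
  "K_class as f = K_class as g \<longleftrightarrow> (\<forall>i<length as. poly f (node i) = poly g (node i))"
proof -
  interpret Q: ring "ring_of_type_algebra :: rat poly ring" by (rule ring_from_type_algebra)
  have "\<ominus>\<^bsub>ring_of_type_algebra\<^esub> g = - g"
    by (rule Q.minus_equality) (simp_all add: ring_of_type_algebra_def)
  then have "f \<ominus>\<^bsub>ring_of_type_algebra\<^esub> g = f - g"
    by (simp add: a_minus_def) (simp add: ring_of_type_algebra_def)
  then have "K_class as f = K_class as g \<longleftrightarrow> chi as dvd f - g"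
    using Q.quotient_eq_iff_same_a_r_cos[OF ideal_chi, of f g]
    by (simp add: K_class_def PIdl_chi) (simp add: ring_of_type_algebra_def)
  then show ?thesis by (simp add: chi_dvd_iff)
qed

text \<open>The value of a residue class of polynomials at the \<open>i\<close>-th node.\<close>

definition coord :: "rat poly set \<Rightarrow> nat \<Rightarrow> rat" where
  "coord Z i = poly (SOME f. K_class as f = Z) (node i)"

lemma coord_K_class: "i < length as \<Longrightarrow> coord (K_class as f) i = poly f (node i)"
  using someI[of "\<lambda>g. K_class as g = K_class as f" f] unfolding coord_def K_class_eq_iff by blast

lemma coord_mult:
  "Z \<in> carrier K \<Longrightarrow> Y \<in> carrier K \<Longrightarrow> i < length as \<Longrightarrow> coord (Z \<otimes>\<^bsub>K\<^esub> Y) i = coord Z i * coord Y i"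
  by (auto simp: carrier_K K_class_mult coord_K_class)

lemma coord_add:
  "Z \<in> carrier K \<Longrightarrow> Y \<in> carrier K \<Longrightarrow> i < length as \<Longrightarrow> coord (Z \<oplus>\<^bsub>K\<^esub> Y) i = coord Z i + coord Y i"
  by (auto simp: carrier_K K_class_add coord_K_class)

lemma coord_one: "i < length as \<Longrightarrow> coord \<one>\<^bsub>K\<^esub> i = 1"
  by (simp add: K_class_one coord_K_class)

lemma coord_zero: "i < length as \<Longrightarrow> coord \<zero>\<^bsub>K\<^esub> i = 0"
  using coord_add[of "\<zero>\<^bsub>K\<^esub>" "\<zero>\<^bsub>K\<^esub>" i] by simp

lemma coord_inv: "Z \<in> carrier K \<Longrightarrow> i < length as \<Longrightarrow> coord (\<ominus>\<^bsub>K\<^esub> Z) i = - coord Z i"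
  using coord_add[of Z "\<ominus>\<^bsub>K\<^esub> Z" i] by (simp add: K.r_neg coord_zero)

lemma coord_eqI:
  assumes "Z \<in> carrier K" "Y \<in> carrier K" "\<And>i. i < length as \<Longrightarrow> coord Z i = coord Y i"
  shows "Z = Y"
proof -
  obtain f g where fg: "Z = K_class as f" "Y = K_class as g" using assms(1,2) by (auto simp: carrier_K)
  show ?thesis unfolding fg K_class_eq_iff using assms(3) by (simp add: fg coord_K_class)
qed

text \<open>Lagrange interpolation, the inverse of the map to coordinates.\<close>

definition elem :: "(nat \<Rightarrow> rat) \<Rightarrow> rat poly set" where
  "elem v = K_class as (\<Sum>k<length as. [:v k / (\<Prod>j\<in>{..<length as} - {k}. node k - node j):] *
     (\<Prod>j\<in>{..<length as} - {k}. [:- node j, 1:]))"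

lemma elem_in_K [simp]: "elem v \<in> carrier K"
  by (simp add: elem_def)

lemma coord_elem: assumes i: "i < length as" shows "coord (elem v) i = v i"
proof -
  let ?D = "\<lambda>k. \<Prod>j\<in>{..<length as} - {k}. node k - node j"
  have D: "?D k \<noteq> 0" if "k < length as" for k using that node_neq[of k] by auto
  have "coord (elem v) i = (\<Sum>k<length as. v k / ?D k * (\<Prod>j\<in>{..<length as} - {k}. node i - node j))"
    using i by (simp add: elem_def coord_K_class poly_sum poly_prod)
  also have "\<dots> = (\<Sum>k\<in>{i}. v k / ?D k * (\<Prod>j\<in>{..<length as} - {k}. node i - node j))"
  proof (rule sum.mono_neutral_right)
    show "\<forall>k\<in>{..<length as} - {i}. v k / ?D k * (\<Prod>j\<in>{..<length as} - {k}. node i - node j) = 0"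
      using i by auto
  qed (use i in auto)
  also have "\<dots> = v i" using D[OF i] by simp
  finally show ?thesis .
qed

lemma poly_of_int_poly: "poly (map_poly of_int f) (of_int c) = (of_int (poly f c) :: rat)"
  by (induction f) (simp_all add: map_poly_pCons)

lemma R_in_K_iff:
  "Z \<in> R_in_K as \<longleftrightarrow> Z \<in> carrier K \<and> (\<exists>x. interp x \<and> (\<forall>i<length as. coord Z i = of_int (x i)))"
proof
  assume "Z \<in> R_in_K as"
  then obtain f :: "int poly" where Z: "Z = K_class as (map_poly of_int f)" by (auto simp: R_in_K_def)
  have "interp (\<lambda>i. poly f (as ! i))" by (rule interpI) simp
  with Z show "Z \<in> carrier K \<and> (\<exists>x. interp x \<and> (\<forall>i<length as. coord Z i = of_int (x i)))"
    by (auto simp: coord_K_class poly_of_int_poly intro!: exI)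
next
  assume "Z \<in> carrier K \<and> (\<exists>x. interp x \<and> (\<forall>i<length as. coord Z i = of_int (x i)))"
  then obtain x f where Z: "Z \<in> carrier K" "\<And>i. i < length as \<Longrightarrow> coord Z i = of_int (x i)"
    and f: "\<forall>i<length as. x i = poly f (as ! i)" by (auto simp: interp_def)
  have "Z = K_class as (map_poly of_int f)"
    by (rule coord_eqI) (use Z f in \<open>auto simp: coord_K_class poly_of_int_poly\<close>)
  then show "Z \<in> R_in_K as" by (simp add: R_in_K_def)
qed

lemma Units_K_iff: "Z \<in> Units K \<longleftrightarrow> Z \<in> carrier K \<and> (\<forall>i<length as. coord Z i \<noteq> 0)"
proof
  assume "Z \<in> Units K"
  then obtain Y where Y: "Z \<in> carrier K" "Y \<in> carrier K" "Z \<otimes>\<^bsub>K\<^esub> Y = \<one>\<^bsub>K\<^esub>"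
    unfolding Units_def by blast
  then have "coord Z i * coord Y i = 1" if "i < length as" for i
    using that coord_mult[of Z Y i] coord_one[of i] by simp
  with Y(1) show "Z \<in> carrier K \<and> (\<forall>i<length as. coord Z i \<noteq> 0)" by fastforce
next
  assume Z: "Z \<in> carrier K \<and> (\<forall>i<length as. coord Z i \<noteq> 0)"
  have "Z \<otimes>\<^bsub>K\<^esub> elem (\<lambda>i. inverse (coord Z i)) = \<one>\<^bsub>K\<^esub>"
    by (rule coord_eqI) (use Z in \<open>auto simp: coord_mult coord_elem coord_one\<close>)
  with Z show "Z \<in> Units K"
    using K.m_comm[of Z "elem (\<lambda>i. inverse (coord Z i))"] unfolding Units_def by force
qed

text \<open>Membership in a multiple of \<open>J\<close> is tested by dividing the coordinates.\<close>

lemma coset_eq_iff: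
  assumes k: "k \<in> Units K" and I: "I \<subseteq> carrier K" and J: "J \<subseteq> carrier K"
  shows "I = k <#\<^bsub>K\<^esub> J \<longleftrightarrow>
    (\<forall>Z\<in>carrier K. Z \<in> I \<longleftrightarrow> elem (\<lambda>i. coord Z i / coord k i) \<in> J)"
proof -
  have kc: "k \<in> carrier K" "\<And>i. i < length as \<Longrightarrow> coord k i \<noteq> 0" using k by (auto simp: Units_K_iff)
  have "Z \<in> k <#\<^bsub>K\<^esub> J \<longleftrightarrow> elem (\<lambda>i. coord Z i / coord k i) \<in> J" if Z: "Z \<in> carrier K" for Z
  proof
    assume "Z \<in> k <#\<^bsub>K\<^esub> J"
    then obtain Y where Y: "Y \<in> J" "Z = k \<otimes>\<^bsub>K\<^esub> Y" by (auto simp: l_coset_def)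
    have "elem (\<lambda>i. coord Z i / coord k i) = Y"
      by (rule coord_eqI) (use Y J kc in \<open>auto simp: coord_elem coord_mult\<close>)
    with Y show "elem (\<lambda>i. coord Z i / coord k i) \<in> J" by simp
  next
    assume Y: "elem (\<lambda>i. coord Z i / coord k i) \<in> J"
    have "Z = k \<otimes>\<^bsub>K\<^esub> elem (\<lambda>i. coord Z i / coord k i)"
      by (rule coord_eqI) (use Z kc in \<open>auto simp: coord_elem coord_mult\<close>)
    with Y show "Z \<in> k <#\<^bsub>K\<^esub> J" by (auto simp: l_coset_def)
  qed
  moreover have "k <#\<^bsub>K\<^esub> J \<subseteq> carrier K" using J kc(1) by (auto simp: l_coset_def)
  ultimately show ?thesis using I by blast
qed

end

section \<open>Fractional ideals as lattices\<close>

lemma common_denominator: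
  fixes S :: "rat set"
  assumes "finite S" shows "\<exists>d :: int. d > 0 \<and> (\<forall>x\<in>S. of_int d * x \<in> \<int>)"
  using assms
proof (induction S rule: finite_induct)
  case empty
  show ?case by (auto intro: exI[of _ 1])
next
  case (insert x S)
  then obtain d :: int where d: "d > 0" "\<And>x. x \<in> S \<Longrightarrow> of_int d * x \<in> \<int>" by blast
  obtain p q where x: "quotient_of x = (p, q)" by fastforce
  then have q: "q > 0" "x = of_int p / of_int q" by (auto intro: quotient_of_denom_pos quotient_of_div)
  have "of_int (d * q) * y \<in> \<int>" if "y \<in> insert x S" for y
  proof (cases "y = x")
    case True
    then have "of_int (d * q) * y = of_int (d * p)" using q by simp
    then show ?thesis by (metis Ints_of_int)
  next
    case False
    then have "y \<in> S" using that by simp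
    from Ints_mult[OF Ints_of_int d(2)[OF this]] have "of_int q * (of_int d * y) \<in> \<int>" .
    then show ?thesis by (simp add: mult_ac)
  qed
  then show ?case using d(1) q(1) by (intro exI[of _ "d * q"]) auto
qed

text \<open>A generator is an element \<open>g\<close> for which \<open>d * g\<close> is the least positive integer of this form.\<close>

lemma cyclic_rat_subgroup:
  fixes S :: "rat set"
  assumes add: "\<And>x y. x \<in> S \<Longrightarrow> y \<in> S \<Longrightarrow> x + y \<in> S"
    and scale: "\<And>x (c :: int). x \<in> S \<Longrightarrow> of_int c * x \<in> S"
    and nonzero: "s \<in> S" "s \<noteq> 0"
    and denominator: "d > 0" "\<And>x. x \<in> S \<Longrightarrow> of_int d * x \<in> \<int>"
  shows "\<exists>g\<in>S. g \<noteq> 0 \<and> (\<forall>x\<in>S. \<exists>z :: int. x = g * of_int z)"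
proof -
  let ?Q = "\<lambda>N :: nat. N > 0 \<and> (\<exists>x\<in>S. of_int d * x = of_nat N)"
  have "\<exists>N. ?Q N"
  proof -
    obtain z :: int where z: "of_int d * s = of_int z" using denominator(2)[OF nonzero(1)] by (auto elim: Ints_cases)
    have "z \<noteq> 0" using z nonzero(2) denominator(1) by auto
    moreover have "of_int d * (of_int (sgn z) * s) = of_nat (nat \<bar>z\<bar>)"
    proof -
      have "of_int d * (of_int (sgn z) * s) = of_int (sgn z) * (of_int d * s)"
        by (rule mult.left_commute)
      also have "\<dots> = of_int (sgn z * z)" by (simp only: z of_int_mult)
      also have "sgn z * z = \<bar>z\<bar>" by (simp add: sgn_if abs_if)
      finally show ?thesis by simp
    qed
    ultimately have "?Q (nat \<bar>z\<bar>)" using scale[OF nonzero(1), of "sgn z"] by auto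
    then show ?thesis by blast
  qed
  then have Q: "?Q (LEAST N. ?Q N)" by (rule LeastI_ex)
  define N where "N = (LEAST N. ?Q N)"
  obtain g where g: "g \<in> S" "of_int d * g = of_nat N" and N: "N > 0" using Q by (auto simp: N_def)
  show ?thesis
  proof (intro bexI conjI ballI)
    show "g \<in> S" by (rule g)
    show "g \<noteq> 0" using g N by auto
    fix x assume x: "x \<in> S"
    obtain z :: int where z: "of_int d * x = of_int z" using denominator(2)[OF x] by (auto elim: Ints_cases)
    define q where "q = z div int N"
    define y where "y = x + of_int (- q) * g"
    have y: "y \<in> S" unfolding y_def by (intro add scale x g)
    have "of_int d * y = of_int z - of_int q * of_nat N"
      using z g(2) by (simp add: y_def algebra_simps)
    also have "\<dots> = of_int (z mod int N)"
      by (simp add: q_def minus_div_mult_eq_mod[symmetric])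
    finally have dy: "of_int d * y = of_int (z mod int N)" .
    have "z mod int N = 0"
    proof (rule ccontr)
      assume "z mod int N \<noteq> 0"
      then have pos: "z mod int N > 0" using N by (simp add: order.not_eq_order_implies_strict)
      then have "?Q (nat (z mod int N))" using y dy by auto
      then have "N \<le> nat (z mod int N)" unfolding N_def by (rule Least_le)
      moreover have "z mod int N < int N" using N by simp
      ultimately show False using pos by linarith
    qed
    then have "y = 0" using dy denominator(1) by simp
    then have "x = g * of_int q" by (simp add: y_def)
    then show "\<exists>z :: int. x = g * of_int z" ..
  qed
qed

context node_list
begin

lemma additive_subgroup_closed:
  assumes "additive_subgroup I K"
  shows "I \<subseteq> carrier K" "Z \<in> I \<Longrightarrow> Y \<in> I \<Longrightarrow> Z \<oplus>\<^bsub>K\<^esub> Y \<in> I" "\<zero>\<^bsub>K\<^esub> \<in> I"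
  using additive_subgroup.a_subset[OF assms] additive_subgroup.a_closed[OF assms]
    additive_subgroup.zero_closed[OF assms] by auto

lemma fractional_idealD:
  assumes "fractional_ideal as I"
  shows "I \<subseteq> carrier K" "\<And>Z Y. Z \<in> I \<Longrightarrow> Y \<in> I \<Longrightarrow> Z \<oplus>\<^bsub>K\<^esub> Y \<in> I" "\<zero>\<^bsub>K\<^esub> \<in> I"
    "\<And>r Z. r \<in> R_in_K as \<Longrightarrow> Z \<in> I \<Longrightarrow> r \<otimes>\<^bsub>K\<^esub> Z \<in> I"
  using assms additive_subgroup_closed unfolding fractional_ideal_def by blast+

lemma elem_in_R: "interp r \<Longrightarrow> elem (\<lambda>i. of_int (r i)) \<in> R_in_K as"
  by (auto simp: R_in_K_iff coord_elem)

text \<open>A fractional ideal is finitely generated as an abelian group, so the coordinates of its generators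
  have a common denominator.\<close>

lemma fractional_ideal_denominator:
  assumes I: "fractional_ideal as I"
  obtains d :: int where "d > 0" "\<And>Z i. Z \<in> I \<Longrightarrow> i < length as \<Longrightarrow> of_int d * coord Z i \<in> \<int>"
proof -
  let ?F = "free_Abelian_group {..<length as}"
  have sub: "subgroup I (add_monoid K)"
    using I unfolding fractional_ideal_def by (blast intro: additive_subgroup.a_subgroup)
  have "(add_monoid K)\<lparr>carrier := I\<rparr> \<cong> ?F" using I by (simp add: fractional_ideal_def)
  from group.iso_sym[OF K.add.subgroup_imp_group[OF sub] this]
  obtain h where h: "h \<in> iso ?F ((add_monoid K)\<lparr>carrier := I\<rparr>)" by (auto simp: is_iso_def)
  have IK: "I \<subseteq> carrier K" by (rule fractional_idealD(1)[OF I])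
  have hI: "h c \<in> I" if "Poly_Mapping.keys c \<subseteq> {..<length as}" for c
    using h that by (auto simp: iso_def hom_def Pi_def)
  have surj: "\<exists>c. Poly_Mapping.keys c \<subseteq> {..<length as} \<and> h c = Z" if "Z \<in> I" for Z
    using h that unfolding iso_iff by (auto simp: image_iff) (metis carrier_free_Abelian_group_iff)
  have add: "coord (h (c + c')) i = coord (h c) i + coord (h c') i"
    if "Poly_Mapping.keys c \<subseteq> {..<length as}" "Poly_Mapping.keys c' \<subseteq> {..<length as}" "i < length as" for c c' i
  proof -
    have "h (c + c') = h c \<oplus>\<^bsub>K\<^esub> h c'" using h that by (auto simp: iso_def hom_def)
    moreover have "h c \<in> carrier K" "h c' \<in> carrier K" using hI that IK by blast+
    ultimately show ?thesis using coord_add[of "h c" "h c'" i] that(3) by simp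
  qed
  let ?S = "(\<lambda>(j, i). coord (h (frag_of j)) i) ` ({..<length as} \<times> {..<length as})"
  have "finite ?S" by simp
  from common_denominator[OF this]
  obtain d :: int where d: "d > 0" "\<And>x. x \<in> ?S \<Longrightarrow> of_int d * x \<in> \<int>" by blast
  have "of_int d * coord (h c) i \<in> \<int>" if i: "i < length as" and c: "Poly_Mapping.keys c \<subseteq> {..<length as}" for c i
  proof (rule free_Abelian_group_induct[OF c])
    have "coord (h 0) i = 0" using add[of 0 0 i] i by simp
    then show "of_int d * coord (h 0) i \<in> \<int>" by simp
  next
    fix x y assume xy: "Poly_Mapping.keys x \<subseteq> {..<length as}" "Poly_Mapping.keys y \<subseteq> {..<length as}"
      "of_int d * coord (h x) i \<in> \<int>" "of_int d * coord (h y) i \<in> \<int>"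
    have "Poly_Mapping.keys (x - y) \<subseteq> {..<length as}" using xy keys_diff[of x y] by auto
    then have "coord (h x) i = coord (h (x - y)) i + coord (h y) i" using add[of "x - y" y i] xy i by simp
    then have "of_int d * coord (h (x - y)) i = of_int d * coord (h x) i - of_int d * coord (h y) i"
      by (simp add: algebra_simps)
    with xy show "of_int d * coord (h (x - y)) i \<in> \<int>" by simp
  next
    fix j assume "j \<in> {..<length as}"
    then show "of_int d * coord (h (frag_of j)) i \<in> \<int>" using d(2) i by auto
  qed
  with d(1) surj show thesis by (intro that[of d]) blast+
qed

text \<open>The rank is \<open>n\<close> because of the triangular basis.\<close>

lemma fractional_ideal_of_lattice:
  fixes L :: "(nat \<Rightarrow> int) set" and m :: int
  assumes add: "\<And>x y. x \<in> L \<Longrightarrow> y \<in> L \<Longrightarrow> (\<lambda>i. x i + y i) \<in> L"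
    and mult: "\<And>r x. interp r \<Longrightarrow> x \<in> L \<Longrightarrow> (\<lambda>i. r i * x i) \<in> L"
    and m: "m > 0" "\<And>w. (\<lambda>i. m * w i) \<in> L"
  defines "I \<equiv> {Z \<in> carrier K. \<exists>x\<in>L. \<forall>i<length as. coord Z i = of_int (x i)}"
  shows "fractional_ideal as I"
proof -
  have sub: "subgroup I (add_monoid K)"
  proof (rule K.add.subgroupI)
    show "I \<subseteq> carrier K" by (auto simp: I_def)
    have "\<zero>\<^bsub>K\<^esub> \<in> I" using m(2)[of "\<lambda>_. 0"] by (auto simp: I_def coord_zero intro!: bexI)
    then show "I \<noteq> {}" by blast
    fix Z assume "Z \<in> I"
    then obtain x where x: "Z \<in> carrier K" "x \<in> L" "\<forall>i<length as. coord Z i = of_int (x i)"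
      by (auto simp: I_def)
    show "\<ominus>\<^bsub>K\<^esub> Z \<in> I"
      using mult[OF interp_const[of "- 1"] x(2)] x(1,3) by (auto simp: I_def coord_inv intro!: bexI)
    fix Y assume "Y \<in> I"
    then obtain y where y: "Y \<in> carrier K" "y \<in> L" "\<forall>i<length as. coord Y i = of_int (y i)"
      by (auto simp: I_def)
    show "Z \<oplus>\<^bsub>K\<^esub> Y \<in> I"
      using add[OF x(2) y(2)] x(1,3) y(1,3) by (auto simp: I_def coord_add intro!: bexI)
  qed
  moreover have "r \<otimes>\<^bsub>K\<^esub> Z \<in> I" if r: "r \<in> R_in_K as" and Z: "Z \<in> I" for r Z
  proof -
    obtain y where y: "r \<in> carrier K" "interp y" "\<forall>i<length as. coord r i = of_int (y i)"
      using r by (auto simp: R_in_K_iff)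
    obtain x where x: "Z \<in> carrier K" "x \<in> L" "\<forall>i<length as. coord Z i = of_int (x i)"
      using Z by (auto simp: I_def)
    show ?thesis
      using mult[OF y(2) x(2)] x(1,3) y(1,3) by (auto simp: I_def coord_mult intro!: bexI)
  qed
  moreover have "(add_monoid K)\<lparr>carrier := I\<rparr> \<cong> free_Abelian_group {..<length as}"
  proof -
    let ?n = "length as"
    have scale: "(\<lambda>i. c * x i) \<in> L" if "x \<in> L" for c x using mult[OF interp_const that] .
    have "\<exists>b. (\<forall>j. b j \<in> L) \<and> (\<forall>j. \<forall>i<j. b j i = 0) \<and> (\<forall>j. b j j \<noteq> 0) \<and>
        (\<forall>x\<in>L. \<forall>k. \<exists>c. \<forall>i<k. x i = (\<Sum>j<k. c j * b j i))"
      by (rule triangular_basis) (use add scale m in auto)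
    then obtain b where basis: "(\<forall>j. b j \<in> L) \<and> (\<forall>j. \<forall>i<j. b j i = 0) \<and> (\<forall>j. b j j \<noteq> 0) \<and>
        (\<forall>x\<in>L. \<forall>k. \<exists>c. \<forall>i<k. x i = (\<Sum>j<k. c j * b j i))" ..
    then have b: "b j \<in> L" "i < j \<Longrightarrow> b j i = 0" "b j j \<noteq> 0" for i j by simp_all
    from basis have expand: "\<exists>c. \<forall>i<k. x i = (\<Sum>j<k. c j * b j i)" if "x \<in> L" for x k
      using that by simp
    define comb where "comb c i = (\<Sum>j<?n. c j * b j i)" for c :: "nat \<Rightarrow> int" and i
    have zero: "(\<lambda>_. 0) \<in> L" using m(2)[of "\<lambda>_. 0"] by simp
    have comb_L: "comb c \<in> L" for c
      unfolding comb_def by (intro closed_sum[OF add zero] scale b)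
    define h where "h c = elem (\<lambda>i. of_int (comb (Poly_Mapping.lookup c) i))" for c
    have coord_h: "coord (h c) i = of_int (comb (Poly_Mapping.lookup c) i)" if "i < ?n" for c i
      using that by (simp add: h_def coord_elem)
    have hK: "h c \<in> carrier K" for c by (simp add: h_def)
    have hI: "h c \<in> I" for c using comb_L hK coord_h by (auto simp: I_def)
    have "h \<in> iso (free_Abelian_group {..<?n}) ((add_monoid K)\<lparr>carrier := I\<rparr>)"
      unfolding iso_iff
    proof (intro conjI)
      show "h \<in> hom (free_Abelian_group {..<?n}) ((add_monoid K)\<lparr>carrier := I\<rparr>)"
      proof (rule homI)
        fix c c' :: "nat \<Rightarrow>\<^sub>0 int"
        have "h (c + c') = h c \<oplus>\<^bsub>K\<^esub> h c'"
          by (rule coord_eqI)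
             (auto simp: hK coord_h coord_add comb_def lookup_add algebra_simps sum.distrib)
        then show "h (c \<otimes>\<^bsub>free_Abelian_group {..<?n}\<^esub> c') = h c \<otimes>\<^bsub>(add_monoid K)\<lparr>carrier := I\<rparr>\<^esub> h c'"
          by simp
      qed (simp add: hI)
      show "h ` carrier (free_Abelian_group {..<?n}) = carrier ((add_monoid K)\<lparr>carrier := I\<rparr>)"
      proof
        show "h ` carrier (free_Abelian_group {..<?n}) \<subseteq> carrier ((add_monoid K)\<lparr>carrier := I\<rparr>)"
          using hI by auto
        show "carrier ((add_monoid K)\<lparr>carrier := I\<rparr>) \<subseteq> h ` carrier (free_Abelian_group {..<?n})"
        proof
          fix Z assume "Z \<in> carrier ((add_monoid K)\<lparr>carrier := I\<rparr>)"
          then obtain x where x: "Z \<in> carrier K" "x \<in> L" "\<forall>i<?n. coord Z i = of_int (x i)"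
            by (auto simp: I_def)
          obtain c where c: "\<forall>i<?n. x i = (\<Sum>j<?n. c j * b j i)" using expand[OF x(2)] by blast
          define c' where "c' = Abs_poly_mapping (\<lambda>j. if j < ?n then c j else 0)"
          have "finite {j. (if j < ?n then c j else 0) \<noteq> 0}"
            by (rule finite_subset[of _ "{..<?n}"]) (auto split: if_splits)
          then have lc: "Poly_Mapping.lookup c' = (\<lambda>j. if j < ?n then c j else 0)"
            unfolding c'_def by (simp add: lookup_Abs_poly_mapping)
          have "Poly_Mapping.keys c' \<subseteq> {..<?n}" by (auto simp: in_keys_iff lc split: if_splits)
          moreover have "Z = h c'"
            by (rule coord_eqI) (use x c hK in \<open>auto simp: coord_h comb_def lc\<close>)
          ultimately show "Z \<in> h ` carrier (free_Abelian_group {..<?n})" by auto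
        qed
      qed
      show "inj_on h (carrier (free_Abelian_group {..<?n}))"
      proof (rule inj_onI)
        fix c c' assume c: "c \<in> carrier (free_Abelian_group {..<?n})" "c' \<in> carrier (free_Abelian_group {..<?n})"
          and eq: "h c = h c'"
        let ?d = "\<lambda>j. Poly_Mapping.lookup c j - Poly_Mapping.lookup c' j"
        have zero: "(\<Sum>j<?n. ?d j * b j i) = 0" if "i < ?n" for i
        proof -
          have "comb (Poly_Mapping.lookup c) i = comb (Poly_Mapping.lookup c') i"
            using coord_h[OF that, of c] coord_h[OF that, of c'] eq by simp
          then show ?thesis by (simp add: comb_def left_diff_distrib sum_subtractf)
        qed
        have "?d i = 0" if "i < ?n" for i by (rule triangular_independent[OF b(2,3) zero that])
        moreover have "?d i = 0" if "\<not> i < ?n" for i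
        proof -
          have "i \<notin> Poly_Mapping.keys c" "i \<notin> Poly_Mapping.keys c'" using c that by auto
          then show ?thesis by (simp add: in_keys_iff)
        qed
        ultimately have "?d i = 0" for i by (cases "i < ?n")
        then show "c = c'" by (intro poly_mapping_eqI) simp
      qed
    qed
    then have "free_Abelian_group {..<?n} \<cong> (add_monoid K)\<lparr>carrier := I\<rparr>" by (auto simp: is_iso_def)
    then show ?thesis by (rule group.iso_sym[OF group_free_Abelian_group])
  qed
  ultimately show ?thesis
    unfolding fractional_ideal_def by (intro conjI ballI additive_subgroupI[OF sub])
qed

end

section \<open>Ideals attached to vectors of unit residues\<close>

context node_list
begin

text \<open>The ideal \<open>uR + \<Delta>\<int>\<^sup>n\<close>.\<close>

definition class_ideal :: "(nat \<Rightarrow> int) \<Rightarrow> rat poly set set" where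
  "class_ideal u = {Z \<in> carrier K. \<exists>r w. interp r \<and>
     (\<forall>i<length as. coord Z i = of_int (u i * r i + vandermonde * w i))}"

lemma class_ideal_sub: "class_ideal u \<subseteq> carrier K"
  by (auto simp: class_ideal_def)

lemma elem_in_class_ideal:
  assumes "interp r" "\<And>i. i < length as \<Longrightarrow> v i = of_int (u i * r i + vandermonde * w i)"
  shows "elem v \<in> class_ideal u"
  unfolding class_ideal_def
  by (intro CollectI conjI exI[of _ r] exI[of _ w] allI impI) (simp_all add: assms coord_elem)

lemma fractional_class_ideal: "fractional_ideal as (class_ideal u)"
proof -
  let ?L = "{x. \<exists>r w. interp r \<and> (\<forall>i. x i = u i * r i + vandermonde * w i)}"
  have "fractional_ideal as {Z \<in> carrier K. \<exists>x\<in>?L. \<forall>i<length as. coord Z i = of_int (x i)}"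
  proof (rule fractional_ideal_of_lattice[OF _ _ vandermonde_pos])
    fix x y assume "x \<in> ?L" "y \<in> ?L"
    then obtain r w s t where "interp r" "interp s" and
      eq: "\<And>i. x i = u i * r i + vandermonde * w i" "\<And>i. y i = u i * s i + vandermonde * t i" by blast
    then have "interp (\<lambda>i. r i + s i)" by (intro interp_add)
    then show "(\<lambda>i. x i + y i) \<in> ?L"
      by (intro CollectI exI[of _ "\<lambda>i. r i + s i"] exI[of _ "\<lambda>i. w i + t i"])
         (simp add: eq algebra_simps)
  next
    fix s x assume s: "interp s" and "x \<in> ?L"
    then obtain r w where "interp r" and eq: "\<And>i. x i = u i * r i + vandermonde * w i" by blast
    then have "interp (\<lambda>i. s i * r i)" using s by (intro interp_mult)
    then show "(\<lambda>i. s i * x i) \<in> ?L"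
      by (intro CollectI exI[of _ "\<lambda>i. s i * r i"] exI[of _ "\<lambda>i. s i * w i"])
         (simp add: eq algebra_simps)
  next
    fix w
    show "(\<lambda>i. vandermonde * w i) \<in> ?L"
      by (intro CollectI exI[of _ "\<lambda>i. 0"] exI[of _ w]) (simp add: interp_const)
  qed
  also have "{Z \<in> carrier K. \<exists>x\<in>?L. \<forall>i<length as. coord Z i = of_int (x i)} = class_ideal u"
  proof
    show "{Z \<in> carrier K. \<exists>x\<in>?L. \<forall>i<length as. coord Z i = of_int (x i)} \<subseteq> class_ideal u"
    proof
      fix Z assume "Z \<in> {Z \<in> carrier K. \<exists>x\<in>?L. \<forall>i<length as. coord Z i = of_int (x i)}"
      then obtain x r w where Z: "Z \<in> carrier K" "interp r" "\<forall>i<length as. coord Z i = of_int (x i)"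
        "\<forall>i. x i = u i * r i + vandermonde * w i" by blast
      then have "\<forall>i<length as. coord Z i = of_int (u i * r i + vandermonde * w i)" by simp
      with Z(1,2) show "Z \<in> class_ideal u" unfolding class_ideal_def by blast
    qed
    show "class_ideal u \<subseteq> {Z \<in> carrier K. \<exists>x\<in>?L. \<forall>i<length as. coord Z i = of_int (x i)}"
    proof
      fix Z assume "Z \<in> class_ideal u"
      then obtain r w where Z: "Z \<in> carrier K" "interp r"
        "\<And>i. i < length as \<Longrightarrow> coord Z i = of_int (u i * r i + vandermonde * w i)"
        unfolding class_ideal_def by blast
      then show "Z \<in> {Z \<in> carrier K. \<exists>x\<in>?L. \<forall>i<length as. coord Z i = of_int (x i)}"
        by (intro CollectI conjI bexI[of _ "\<lambda>i. u i * r i + vandermonde * w i"]) auto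
    qed
  qed
  finally show ?thesis .
qed

text \<open>If \<open>s\<close> is the inverse of \<open>u\<close> modulo \<open>\<Delta>\<^sup>2\<close>, the ideal of \<open>s\<close> is the inverse of that of \<open>u\<close>.  Working
  modulo \<open>\<Delta>\<^sup>2\<close> gives \<open>1 = u s + \<Delta> (- \<Delta> t)\<close>, which is a sum of two products of elements of the
  two ideals.\<close>

lemma invertible_class_ideal:
  assumes u: "u \<in> residue_units" shows "invertible_ideal as (class_ideal u)"
proof -
  have "\<exists>s. [u i * s = 1] (mod vandermonde\<^sup>2)" if "i < length as" for i
    using residue_unitsD(1)[OF u that] by (intro cong_solve_coprime_int) simp
  then obtain s where "\<And>i. i < length as \<Longrightarrow> [u i * s i = 1] (mod vandermonde\<^sup>2)" by metis
  then have "\<exists>t. u i * s i = 1 + vandermonde\<^sup>2 * t" if "i < length as" for i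
    using that by (metis cong_iff_lin cong_sym)
  then obtain t where st: "\<And>i. i < length as \<Longrightarrow> u i * s i = 1 + vandermonde\<^sup>2 * t i" by metis
  let ?P = "class_ideal u \<cdot>\<^bsub>K\<^esub> class_ideal s"
  have "?P \<subseteq> R_in_K as"
  proof
    fix Z assume "Z \<in> ?P"
    then show "Z \<in> R_in_K as"
    proof (induction rule: ideal_prod.induct)
      case (prod A B)
      obtain r w where A: "A \<in> carrier K" "interp r"
        "\<And>i. i < length as \<Longrightarrow> coord A i = of_int (u i * r i + vandermonde * w i)"
        using prod(1) unfolding class_ideal_def by blast
      obtain r' w' where B: "B \<in> carrier K" "interp r'"
        "\<And>i. i < length as \<Longrightarrow> coord B i = of_int (s i * r' i + vandermonde * w' i)"
        using prod(2) unfolding class_ideal_def by blast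
      let ?x = "\<lambda>i. (u i * r i + vandermonde * w i) * (s i * r' i + vandermonde * w' i)"
      have "interp ?x"
      proof (rule interp_cong_vandermonde)
        show "interp (\<lambda>i. r i * r' i)" using A(2) B(2) by (rule interp_mult)
        fix i assume i: "i < length as"
        have "?x i - r i * r' i = (u i * s i - 1) * (r i * r' i)
            + vandermonde * (u i * r i * w' i + w i * s i * r' i + vandermonde * w i * w' i)"
          by (simp add: algebra_simps)
        also have "\<dots> = vandermonde * (vandermonde * t i * (r i * r' i)
            + (u i * r i * w' i + w i * s i * r' i + vandermonde * w i * w' i))"
          using st[OF i] by (simp add: algebra_simps power2_eq_square)
        finally show "[?x i = r i * r' i] (mod vandermonde)" by (simp add: cong_iff_dvd_diff)
      qed
      moreover have "coord (A \<otimes>\<^bsub>K\<^esub> B) i = of_int (?x i)" if "i < length as" for i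
        using A(1,3) B(1,3) that by (simp add: coord_mult)
      ultimately show ?case unfolding R_in_K_iff using A(1) B(1) by blast
    next
      case (sum A B)
      then obtain x y where "A \<in> carrier K" "interp x" "\<forall>i<length as. coord A i = of_int (x i)"
        "B \<in> carrier K" "interp y" "\<forall>i<length as. coord B i = of_int (y i)" by (auto simp: R_in_K_iff)
      then show ?case unfolding R_in_K_iff
        by (intro conjI exI[of _ "\<lambda>i. x i + y i"] interp_add) (auto simp: coord_add)
    qed
  qed
  moreover have "R_in_K as \<subseteq> ?P"
  proof
    fix Z assume "Z \<in> R_in_K as"
    then obtain x where x: "Z \<in> carrier K" "interp x" "\<And>i. i < length as \<Longrightarrow> coord Z i = of_int (x i)"
      by (auto simp: R_in_K_iff)
    let ?A = "elem (\<lambda>i. of_int (u i * x i))" and ?B = "elem (\<lambda>i. of_int (s i))"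
    let ?C = "elem (\<lambda>i. of_int (vandermonde * x i))" and ?D = "elem (\<lambda>i. of_int (vandermonde * - t i))"
    have A: "?A \<in> class_ideal u" by (rule elem_in_class_ideal[OF x(2), of _ _ "\<lambda>_. 0"]) simp
    have B: "?B \<in> class_ideal s"
      by (rule elem_in_class_ideal[OF interp_const[of 1], of _ _ "\<lambda>_. 0"]) simp
    have C: "?C \<in> class_ideal u"
      by (rule elem_in_class_ideal[OF interp_const[of 0], of _ _ x]) simp
    have D: "?D \<in> class_ideal s"
      by (rule elem_in_class_ideal[OF interp_const[of 0], of _ _ "\<lambda>i. - t i"]) simp
    have "?A \<otimes>\<^bsub>K\<^esub> ?B \<oplus>\<^bsub>K\<^esub> ?C \<otimes>\<^bsub>K\<^esub> ?D \<in> ?P"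
      by (intro ideal_prod.sum ideal_prod.prod A B C D)
    moreover have "Z = ?A \<otimes>\<^bsub>K\<^esub> ?B \<oplus>\<^bsub>K\<^esub> ?C \<otimes>\<^bsub>K\<^esub> ?D"
    proof (rule coord_eqI)
      fix i assume i: "i < length as"
      have "x i = (u i * s i) * x i + vandermonde * x i * (vandermonde * - t i)"
        unfolding st[OF i] by (simp add: algebra_simps power2_eq_square)
      also have "\<dots> = u i * x i * s i + vandermonde * x i * (vandermonde * - t i)" by simp
      finally have "(of_int (x i) :: rat) = of_int (u i * x i * s i + vandermonde * x i * (vandermonde * - t i))"
        by (rule arg_cong)
      then show "coord Z i = coord (?A \<otimes>\<^bsub>K\<^esub> ?B \<oplus>\<^bsub>K\<^esub> ?C \<otimes>\<^bsub>K\<^esub> ?D) i"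
        using x(3)[OF i] i by (simp add: coord_add coord_mult coord_elem)
    qed (use x in auto)
    ultimately show "Z \<in> ?P" by simp
  qed
  ultimately have "?P = R_in_K as" by blast
  then show ?thesis
    unfolding invertible_ideal_def using fractional_class_ideal by blast
qed

text \<open>A sign is its own inverse, so multiplying by \<open>e\<close> is the same as dividing by \<open>e\<close>.\<close>

lemma class_ideal_scale:
  assumes r: "interp r"
    and eq: "\<And>i. i < length as \<Longrightarrow> e i \<in> {1, - 1 :: int}"
      "\<And>i. i < length as \<Longrightarrow> [u i = e i * v i * r i] (mod vandermonde)"
    and Z: "Z \<in> class_ideal u"
  shows "elem (\<lambda>i. coord Z i * of_int (e i)) \<in> class_ideal v"
proof -
  obtain r' w where Z: "Z \<in> carrier K" "interp r'"
    "\<And>i. i < length as \<Longrightarrow> coord Z i = of_int (u i * r' i + vandermonde * w i)"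
    using Z unfolding class_ideal_def by blast
  have "\<exists>t. u i = e i * v i * r i + vandermonde * t" if "i < length as" for i
    using eq(2)[OF that] by (metis cong_iff_lin cong_sym)
  then obtain t where t: "\<And>i. i < length as \<Longrightarrow> u i = e i * v i * r i + vandermonde * t i" by metis
  show ?thesis
  proof (rule elem_in_class_ideal)
    show "interp (\<lambda>i. r i * r' i)" by (rule interp_mult[OF r Z(2)])
    fix i assume i: "i < length as"
    have ee: "e i * e i = 1" using eq(1)[OF i] by auto
    have "(u i * r' i + vandermonde * w i) * e i
        = (e i * e i) * (v i * (r i * r' i)) + vandermonde * (e i * (t i * r' i + w i))"
      unfolding t[OF i] by (simp add: algebra_simps)
    then have "(u i * r' i + vandermonde * w i) * e i = v i * (r i * r' i) + vandermonde * (e i * (t i * r' i + w i))"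
      by (simp add: ee)
    then have "(of_int ((u i * r' i + vandermonde * w i) * e i) :: rat)
        = of_int (v i * (r i * r' i) + vandermonde * (e i * (t i * r' i + w i)))"
      by (rule arg_cong)
    then show "coord Z i * of_int (e i) = of_int (v i * (r i * r' i) + vandermonde * (e i * (t i * r' i + w i)))"
      using Z(3)[OF i] by simp
  qed
qed

lemma class_ideal_coord_one:
  assumes "u \<in> residue_units" "i < length as"
  obtains Z where "Z \<in> class_ideal u" "coord Z i = 1"
proof -
  have "coprime (u i) vandermonde" by (rule residue_unitsD(1)[OF assms])
  then obtain s where "[u i * s = 1] (mod vandermonde)" using cong_solve_coprime_int by blast
  then obtain t where "1 = u i * s + vandermonde * t" by (metis cong_iff_lin)
  then have "coord (elem (\<lambda>j. of_int (u j * s + vandermonde * t))) i = 1"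
    using assms(2) by (metis coord_elem of_int_1)
  moreover have "elem (\<lambda>j. of_int (u j * s + vandermonde * t)) \<in> class_ideal u"
    by (rule elem_in_class_ideal[OF interp_const]) simp
  ultimately show thesis using that by blast
qed

lemma class_ideal_coord_int: "Z \<in> class_ideal u \<Longrightarrow> i < length as \<Longrightarrow> coord Z i \<in> \<int>"
  by (auto simp: class_ideal_def)

text \<open>All coordinate projections of the two ideals are \<open>\<int>\<close> (lemmas \<open>class_ideal_coord_one\<close> and
  \<open>class_ideal_coord_int\<close>), so the coordinates of a scalar that carries one to the other are units of
  \<open>\<int>\<close>.\<close>

lemma class_ideal_equiv_iff:
  assumes u: "u \<in> residue_units" and v: "v \<in> residue_units"
  shows "(class_ideal u, class_ideal v) \<in> ideal_equiv as \<longleftrightarrow> associated u v"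
proof
  assume "(class_ideal u, class_ideal v) \<in> ideal_equiv as"
  then obtain k where k: "k \<in> Units K" "class_ideal u = k <#\<^bsub>K\<^esub> class_ideal v"
    by (auto simp: ideal_equiv_def)
  have kc: "k \<in> carrier K" "\<And>i. i < length as \<Longrightarrow> coord k i \<noteq> 0" using k(1) by (auto simp: Units_K_iff)
  have scale: "Z \<in> class_ideal u \<longleftrightarrow> elem (\<lambda>i. coord Z i / coord k i) \<in> class_ideal v" if "Z \<in> carrier K" for Z
    using coset_eq_iff[OF k(1) class_ideal_sub class_ideal_sub, of u v] k(2) that by simp
  have "\<exists>e\<in>{1, - 1 :: int}. coord k i = of_int e" if i: "i < length as" for i
  proof -
    obtain Z where Z: "Z \<in> class_ideal u" "coord Z i = 1" using class_ideal_coord_one[OF u i] .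
    then have "elem (\<lambda>i. coord Z i / coord k i) \<in> class_ideal v" using scale[of Z] class_ideal_sub by blast
    from class_ideal_coord_int[OF this i] have "1 / coord k i \<in> \<int>" using Z(2) i by (simp add: coord_elem)
    then obtain p :: int where p: "1 / coord k i = of_int p" by (auto elim: Ints_cases)
    obtain Y where Y: "Y \<in> class_ideal v" "coord Y i = 1" using class_ideal_coord_one[OF v i] .
    have "k \<otimes>\<^bsub>K\<^esub> Y \<in> class_ideal u" unfolding k(2) using Y(1) by (auto simp: l_coset_def)
    from class_ideal_coord_int[OF this i] have "coord k i \<in> \<int>"
      using Y(2) kc(1) subsetD[OF class_ideal_sub Y(1)] i by (simp add: coord_mult)
    then obtain q :: int where q: "coord k i = of_int q" by (auto elim: Ints_cases)
    have "(of_int (p * q) :: rat) = 1" using p q kc(2)[OF i] by (simp add: field_simps)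
    then have "p * q = 1" by linarith
    then have "q = 1 \<or> q = - 1" by (auto simp: zmult_eq_1_iff)
    then show ?thesis using q by auto
  qed
  then obtain e where e: "\<And>i. i < length as \<Longrightarrow> e i \<in> {1, - 1 :: int}"
    "\<And>i. i < length as \<Longrightarrow> coord k i = of_int (e i)" by metis
  have "elem (\<lambda>i. of_int (u i)) \<in> class_ideal u"
    by (rule elem_in_class_ideal[OF interp_const[of 1], of _ _ "\<lambda>_. 0"]) simp
  then have "elem (\<lambda>i. coord (elem (\<lambda>i. of_int (u i))) i / coord k i) \<in> class_ideal v"
    using scale[of "elem (\<lambda>i. of_int (u i))"] by simp
  then obtain r w where r: "interp r" "\<And>i. i < length as \<Longrightarrow>
      coord (elem (\<lambda>i. coord (elem (\<lambda>i. of_int (u i))) i / coord k i)) i = of_int (v i * r i + vandermonde * w i)"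
    unfolding class_ideal_def by blast
  have "[u i = e i * v i * r i] (mod vandermonde)" if i: "i < length as" for i
  proof -
    have "(of_int (u i) :: rat) / of_int (e i) = of_int (v i * r i + vandermonde * w i)"
      using r(2)[OF i] e(2)[OF i] i by (simp add: coord_elem)
    moreover have "(of_int (e i) :: rat) \<noteq> 0" using e(1)[OF i] by auto
    ultimately have "(of_int (u i) :: rat) = of_int (e i * (v i * r i + vandermonde * w i))"
      by (simp add: field_simps)
    then have "u i = e i * (v i * r i + vandermonde * w i)" by linarith
    then have "u i - e i * v i * r i = vandermonde * (e i * w i)" by (simp add: algebra_simps)
    then show ?thesis by (simp add: cong_iff_dvd_diff)
  qed
  with e(1) r(1) show "associated u v" unfolding associated_def by blast
next
  assume "associated u v"
  then obtain e r where r: "interp r" and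
    eq: "\<And>i. i < length as \<Longrightarrow> e i \<in> {1, - 1}" "\<And>i. i < length as \<Longrightarrow> [u i = e i * v i * r i] (mod vandermonde)"
    by (auto simp: associated_def)
  obtain s where s: "interp s" "\<And>i. i < length as \<Longrightarrow> [v i = e i * u i * s i] (mod vandermonde)"
    using associated_inverse[OF u r eq] by blast
  let ?k = "elem (\<lambda>i. of_int (e i))"
  have e0: "e i \<noteq> 0" "e i * e i = 1" if "i < length as" for i using eq(1)[OF that] by auto
  have k: "?k \<in> Units K" using e0 by (simp add: Units_K_iff coord_elem)
  have same: "elem (\<lambda>i. coord Z i / coord ?k i) = elem (\<lambda>i. coord Z i * of_int (e i))" for Z
  proof (rule coord_eqI)
    fix i assume i: "i < length as"
    have "e i = 1 \<or> e i = - 1" using eq(1)[OF i] by auto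
    then show "coord (elem (\<lambda>i. coord Z i / coord ?k i)) i = coord (elem (\<lambda>i. coord Z i * of_int (e i))) i"
      using i by (auto simp: coord_elem)
  qed auto
  have "class_ideal u = ?k <#\<^bsub>K\<^esub> class_ideal v"
    unfolding coset_eq_iff[OF k class_ideal_sub class_ideal_sub] same
  proof (intro ballI iffI)
    fix Z assume "Z \<in> class_ideal u"
    then show "elem (\<lambda>i. coord Z i * of_int (e i)) \<in> class_ideal v"
      using class_ideal_scale[OF r eq] by blast
  next
    fix Z assume Z: "Z \<in> carrier K" "elem (\<lambda>i. coord Z i * of_int (e i)) \<in> class_ideal v"
    have "elem (\<lambda>i. coord (elem (\<lambda>i. coord Z i * of_int (e i))) i * of_int (e i)) \<in> class_ideal u"
      using class_ideal_scale[OF s(1) eq(1) s(2) Z(2)] by blast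
    also have "elem (\<lambda>i. coord (elem (\<lambda>i. coord Z i * of_int (e i))) i * of_int (e i)) = Z"
    proof (rule coord_eqI)
      fix i assume i: "i < length as"
      have "e i = 1 \<or> e i = - 1" using eq(1)[OF i] by auto
      then show "coord (elem (\<lambda>i. coord (elem (\<lambda>i. coord Z i * of_int (e i))) i * of_int (e i))) i = coord Z i"
        using i by (auto simp: coord_elem)
    qed (use Z in auto)
    finally show "Z \<in> class_ideal u" .
  qed
  then show "(class_ideal u, class_ideal v) \<in> ideal_equiv as"
    using k fractional_class_ideal[of u] fractional_class_ideal[of v] unfolding ideal_equiv_def by blast
qed

end

section \<open>The class group\<close>

context node_list
begin

lemma coset_coset:
  assumes "k \<in> carrier K" "l \<in> carrier K" "J \<subseteq> carrier K"
  shows "k <#\<^bsub>K\<^esub> (l <#\<^bsub>K\<^esub> J) = (k \<otimes>\<^bsub>K\<^esub> l) <#\<^bsub>K\<^esub> J"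
proof -
  have "k \<otimes>\<^bsub>K\<^esub> (l \<otimes>\<^bsub>K\<^esub> h) = k \<otimes>\<^bsub>K\<^esub> l \<otimes>\<^bsub>K\<^esub> h" if "h \<in> J" for h
    using assms that by (simp add: K.m_assoc subset_iff)
  then show ?thesis by (simp add: l_coset_def)
qed

lemma coset_one: "J \<subseteq> carrier K \<Longrightarrow> \<one>\<^bsub>K\<^esub> <#\<^bsub>K\<^esub> J = J"
  by (auto simp: l_coset_def subset_iff)

lemma equiv_ideal_equiv: "equiv {I. fractional_ideal as I} (ideal_equiv as)"
proof (rule equivI)
  show "ideal_equiv as \<subseteq> {I. fractional_ideal as I} \<times> {I. fractional_ideal as I}"
    by (auto simp: ideal_equiv_def)
  show "refl_on {I. fractional_ideal as I} (ideal_equiv as)"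
  proof (rule refl_onI)
    fix I assume "I \<in> {I. fractional_ideal as I}"
    then have "fractional_ideal as I" by simp
    moreover from this have "I = \<one>\<^bsub>K\<^esub> <#\<^bsub>K\<^esub> I" by (simp add: coset_one fractional_idealD(1))
    ultimately show "(I, I) \<in> ideal_equiv as"
      unfolding ideal_equiv_def using K.Units_one_closed by blast
  qed
  show "sym (ideal_equiv as)"
  proof (rule symI)
    fix I J assume "(I, J) \<in> ideal_equiv as"
    then obtain k where k: "fractional_ideal as I" "fractional_ideal as J" "k \<in> Units K" "I = k <#\<^bsub>K\<^esub> J"
      unfolding ideal_equiv_def by blast
    have "inv\<^bsub>K\<^esub> k <#\<^bsub>K\<^esub> I = J"
      unfolding k(4) using k(3) fractional_idealD(1)[OF k(2)]
      by (subst coset_coset) (auto simp: coset_one)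
    then show "(J, I) \<in> ideal_equiv as"
      unfolding ideal_equiv_def using k K.Units_inv_Units by blast
  qed
  show "trans (ideal_equiv as)"
  proof (rule transI)
    fix I J H assume "(I, J) \<in> ideal_equiv as" "(J, H) \<in> ideal_equiv as"
    then obtain k l where k: "fractional_ideal as I" "k \<in> Units K" "I = k <#\<^bsub>K\<^esub> J"
      and l: "fractional_ideal as H" "l \<in> Units K" "J = l <#\<^bsub>K\<^esub> H"
      unfolding ideal_equiv_def by blast
    have "I = (k \<otimes>\<^bsub>K\<^esub> l) <#\<^bsub>K\<^esub> H"
      unfolding k(3) l(3) using k(2) l(2) fractional_idealD(1)[OF l(1)] by (intro coset_coset) auto
    then show "(I, H) \<in> ideal_equiv as"
      unfolding ideal_equiv_def using k l K.Units_m_closed by blast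
  qed
qed

text \<open>For \<open>T = {0}\<close> and \<open>T = p\<int>\<close> this shows that the products of elements of two mutually inverse ideals
  do not all lie in a maximal ideal of \<open>\<rat>\<^sup>n\<close> or \<open>\<int>\<^sup>n\<close>, since \<open>1\<close> does not.\<close>

lemma ideal_prod_coord:
  assumes IJ: "I \<subseteq> carrier K" "J \<subseteq> carrier K" and i: "i < length as"
    and T: "\<And>x y. x \<in> T \<Longrightarrow> y \<in> T \<Longrightarrow> x + y \<in> T"
      "\<And>A B. A \<in> I \<Longrightarrow> B \<in> J \<Longrightarrow> coord A i * coord B i \<in> T"
    and Z: "Z \<in> I \<cdot>\<^bsub>K\<^esub> J"
  shows "coord Z i \<in> T"
proof -
  have "Z \<in> carrier K \<and> coord Z i \<in> T" using Z
  proof (induction rule: ideal_prod.induct)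
    case (prod A B)
    then have "A \<in> carrier K" "B \<in> carrier K" using IJ by auto
    then show ?case using T(2)[OF prod] i by (simp add: coord_mult)
  next
    case (sum A B)
    then show ?case using T(1) i by (simp add: coord_add)
  qed
  then show ?thesis ..
qed

text \<open>Each coordinate projection of \<open>I\<close> is a nonzero finitely generated, hence cyclic, subgroup of \<open>\<rat>\<close>.
  Dividing \<open>I\<close>, and multiplying its inverse \<open>J\<close>, by a vector \<open>g\<close> of generators yields a pair of lattices to which
  \<open>invertible_lattice\<close> applies.\<close>

lemma invertible_ideal_equiv_class_ideal:
  assumes "invertible_ideal as I"
  shows "\<exists>u\<in>residue_units. (I, class_ideal u) \<in> ideal_equiv as"
proof -
  obtain J where I: "fractional_ideal as I" and J: "fractional_ideal as J" and IJ: "I \<cdot>\<^bsub>K\<^esub> J = R_in_K as"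
    using assms unfolding invertible_ideal_def by blast
  note IK = fractional_idealD(1)[OF I] and JK = fractional_idealD(1)[OF J]
  have "interp (\<lambda>_. 1)" by (rule interp_const)
  then have one: "\<one>\<^bsub>K\<^esub> \<in> I \<cdot>\<^bsub>K\<^esub> J"
    unfolding IJ R_in_K_iff by (intro conjI exI[of _ "\<lambda>_. 1"]) (auto simp: coord_one)
  have product: "\<exists>x. interp x \<and> (\<forall>i<length as. coord A i * coord B i = of_int (x i))"
    if A: "A \<in> I" and B: "B \<in> J" for A B
  proof -
    have AB: "A \<in> carrier K" "B \<in> carrier K" using A B IK JK by auto
    have "A \<otimes>\<^bsub>K\<^esub> B \<in> R_in_K as" unfolding IJ[symmetric] using A B by (rule ideal_prod.prod)
    then obtain x where "interp x" "\<forall>i<length as. coord (A \<otimes>\<^bsub>K\<^esub> B) i = of_int (x i)"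
      unfolding R_in_K_iff by blast
    then show ?thesis using AB by (intro exI[of _ x]) (simp add: coord_mult)
  qed
  obtain d :: int where d: "d > 0" "\<And>Z i. Z \<in> I \<Longrightarrow> i < length as \<Longrightarrow> of_int d * coord Z i \<in> \<int>"
    using fractional_ideal_denominator[OF I] by blast
  have scale: "elem (\<lambda>i. of_int (r i)) \<otimes>\<^bsub>K\<^esub> Z \<in> I'"
    if "fractional_ideal as I'" "interp r" "Z \<in> I'" for r Z I'
    using fractional_idealD(4)[OF that(1) elem_in_R[OF that(2)] that(3)] .
  have "\<exists>g. (\<exists>Z\<in>I. coord Z i = g) \<and> g \<noteq> 0 \<and> (\<forall>Z\<in>I. \<exists>z :: int. coord Z i = g * of_int z)"
    if i: "i < length as" for i
  proof -
    have "\<exists>A\<in>I. \<exists>B\<in>J. coord A i * coord B i \<noteq> 0"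
    proof (rule ccontr)
      assume "\<not> ?thesis"
      then have "coord \<one>\<^bsub>K\<^esub> i \<in> {0}" by (intro ideal_prod_coord[OF IK JK i _ _ one]) auto
      then show False using i by (simp add: coord_one)
    qed
    then obtain A where A: "A \<in> I" "coord A i \<noteq> 0" by auto
    let ?S = "(\<lambda>Z. coord Z i) ` I"
    obtain g where "g \<in> ?S" "g \<noteq> 0" "\<forall>x\<in>?S. \<exists>z :: int. x = g * of_int z"
    proof -
      have "\<exists>g\<in>?S. g \<noteq> 0 \<and> (\<forall>x\<in>?S. \<exists>z :: int. x = g * of_int z)"
      proof (rule cyclic_rat_subgroup)
        fix x y assume "x \<in> ?S" "y \<in> ?S"
        then obtain Z Y where "Z \<in> I" "Y \<in> I" "x = coord Z i" "y = coord Y i" by auto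
        then show "x + y \<in> ?S" using fractional_idealD(2)[OF I, of Z Y] IK i
          by (auto simp: image_iff coord_add subset_iff intro!: bexI[of _ "Z \<oplus>\<^bsub>K\<^esub> Y"])
      next
        fix x and c :: int assume "x \<in> ?S"
        then obtain Z where Z: "Z \<in> I" "x = coord Z i" by auto
        then show "of_int c * x \<in> ?S" using scale[OF I interp_const[of c] Z(1)] IK i
          by (auto simp: image_iff coord_mult coord_elem subset_iff
              intro!: bexI[of _ "elem (\<lambda>i. of_int c) \<otimes>\<^bsub>K\<^esub> Z"])
      qed (use A d i in auto)
      then show thesis using that by blast
    qed
    then show ?thesis by blast
  qed
  then obtain g where g: "\<And>i. i < length as \<Longrightarrow> \<exists>Z\<in>I. coord Z i = g i"
    "\<And>i. i < length as \<Longrightarrow> g i \<noteq> 0"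
    "\<And>i Z. i < length as \<Longrightarrow> Z \<in> I \<Longrightarrow> \<exists>z :: int. coord Z i = g i * of_int z"
    by metis
  \<comment> \<open>The lattices of \<open>I / g\<close> and \<open>g J\<close>.\<close>
  let ?L = "{x. \<exists>Z\<in>I. \<forall>i<length as. coord Z i = g i * of_int (x i)}"
  let ?M = "{y. \<exists>Y\<in>J. \<forall>i<length as. g i * coord Y i = of_int (y i)}"
  have coordsI: "\<exists>x\<in>?L. \<forall>i<length as. coord Z i = g i * of_int (x i)" if Z: "Z \<in> I" for Z
  proof -
    obtain x where "\<And>i. i < length as \<Longrightarrow> coord Z i = g i * of_int (x i)" using g(3)[OF _ Z] by metis
    then show ?thesis using Z by blast
  qed
  have coordsJ: "\<exists>y\<in>?M. \<forall>i<length as. g i * coord Y i = of_int (y i)" if Y: "Y \<in> J" for Y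
  proof -
    have "\<exists>z :: int. g i * coord Y i = of_int z" if i: "i < length as" for i
    proof -
      obtain Z where "Z \<in> I" "coord Z i = g i" using g(1)[OF i] by blast
      then show ?thesis using product[OF _ Y, of Z] i by metis
    qed
    then obtain y where "\<And>i. i < length as \<Longrightarrow> g i * coord Y i = of_int (y i)" by metis
    then show ?thesis using Y by blast
  qed
  have "\<exists>u\<in>residue_units. \<forall>x. x \<in> ?L \<longleftrightarrow>
      (\<exists>r w. interp r \<and> (\<forall>i<length as. x i = u i * r i + vandermonde * w i))"
  proof (rule invertible_lattice[where M = ?M])
    fix x y assume "x \<in> ?L" "\<And>i. i < length as \<Longrightarrow> x i = y i"
    then show "y \<in> ?L" by simp
  next
    fix x y assume "x \<in> ?L" "y \<in> ?L"
    then obtain Z Y where "Z \<in> I" "Y \<in> I" "\<forall>i<length as. coord Z i = g i * of_int (x i)"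
      "\<forall>i<length as. coord Y i = g i * of_int (y i)" by blast
    then show "(\<lambda>i. x i + y i) \<in> ?L" using fractional_idealD(2)[OF I, of Z Y] IK
      by (intro CollectI bexI[of _ "Z \<oplus>\<^bsub>K\<^esub> Y"]) (auto simp: coord_add subset_iff algebra_simps)
  next
    fix x y assume "x \<in> ?M" "y \<in> ?M"
    then obtain Z Y where "Z \<in> J" "Y \<in> J" "\<forall>i<length as. g i * coord Z i = of_int (x i)"
      "\<forall>i<length as. g i * coord Y i = of_int (y i)" by blast
    then show "(\<lambda>i. x i + y i) \<in> ?M" using fractional_idealD(2)[OF J, of Z Y] JK
      by (intro CollectI bexI[of _ "Z \<oplus>\<^bsub>K\<^esub> Y"]) (auto simp: coord_add subset_iff algebra_simps)
  next
    show "(\<lambda>_. 0) \<in> ?L" using fractional_idealD(3)[OF I]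
      by (intro CollectI bexI[of _ "\<zero>\<^bsub>K\<^esub>"]) (auto simp: coord_zero)
    show "(\<lambda>_. 0) \<in> ?M" using fractional_idealD(3)[OF J]
      by (intro CollectI bexI[of _ "\<zero>\<^bsub>K\<^esub>"]) (auto simp: coord_zero)
  next
    fix r x assume r: "interp r" and "x \<in> ?L"
    then obtain Z where "Z \<in> I" "\<forall>i<length as. coord Z i = g i * of_int (x i)" by blast
    then show "(\<lambda>i. r i * x i) \<in> ?L" using scale[OF I r, of Z] IK
      by (intro CollectI bexI[of _ "elem (\<lambda>i. of_int (r i)) \<otimes>\<^bsub>K\<^esub> Z"])
         (auto simp: coord_mult coord_elem subset_iff)
  next
    fix r x assume r: "interp r" and "x \<in> ?M"
    then obtain Z where Z: "Z \<in> J" "\<forall>i<length as. g i * coord Z i = of_int (x i)" by blast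
    have "g i * (of_int (r i) * coord Z i) = of_int (r i * x i)" if "i < length as" for i
      using Z(2) that by (simp add: mult.left_commute)
    then show "(\<lambda>i. r i * x i) \<in> ?M" using scale[OF J r Z(1)] JK Z(1)
      by (intro CollectI bexI[of _ "elem (\<lambda>i. of_int (r i)) \<otimes>\<^bsub>K\<^esub> Z"])
         (auto simp: coord_mult coord_elem subset_iff)
  next
    fix i assume i: "i < length as"
    then obtain Z where Z: "Z \<in> I" "coord Z i = g i" using g(1) by blast
    obtain x where "x \<in> ?L" "\<forall>i<length as. coord Z i = g i * of_int (x i)" using coordsI[OF Z(1)] by blast
    moreover from this have "x i = 1" using Z(2) g(2)[OF i] i by simp
    ultimately show "\<exists>x\<in>?L. x i = 1" by blast
  next
    fix x y assume "x \<in> ?L" "y \<in> ?M"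
    then obtain Z Y where ZY: "Z \<in> I" "Y \<in> J" "\<forall>i<length as. coord Z i = g i * of_int (x i)"
      "\<forall>i<length as. g i * coord Y i = of_int (y i)" by blast
    obtain z where z: "interp z" "\<forall>i<length as. coord Z i * coord Y i = of_int (z i)"
      using product[OF ZY(1,2)] by blast
    have "z i = x i * y i" if "i < length as" for i
    proof -
      have "(of_int (z i) :: rat) = coord Z i * coord Y i" using z(2) that by simp
      also have "\<dots> = of_int (x i) * (g i * coord Y i)" using ZY(3) that by simp
      also have "\<dots> = of_int (x i * y i)" using ZY(4) that by simp
      finally show ?thesis by (simp only: of_int_eq_iff)
    qed
    then show "interp (\<lambda>i. x i * y i)" by (rule interp_cong[OF z(1)])
  next
    fix p i assume p: "prime (p :: nat)" and i: "i < length as"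
    show "\<exists>x\<in>?L. \<exists>y\<in>?M. \<not> int p dvd x i * y i"
    proof (rule ccontr)
      assume all: "\<not> ?thesis"
      have "coord \<one>\<^bsub>K\<^esub> i \<in> range (\<lambda>z. of_int (int p * z))"
      proof (rule ideal_prod_coord[OF IK JK i _ _ one])
        fix x y :: rat assume "x \<in> range (\<lambda>z. of_int (int p * z))" "y \<in> range (\<lambda>z. of_int (int p * z))"
        then obtain z w where "x = of_int (int p * z)" "y = of_int (int p * w)" by blast
        then have "x + y = of_int (int p * (z + w))" by (simp add: algebra_simps)
        then show "x + y \<in> range (\<lambda>z. of_int (int p * z))" by (rule range_eqI)
      next
        fix A B assume "A \<in> I" "B \<in> J"
        obtain x where x: "x \<in> ?L" "\<forall>i<length as. coord A i = g i * of_int (x i)"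
          using coordsI[OF \<open>A \<in> I\<close>] by blast
        obtain y where y: "y \<in> ?M" "\<forall>i<length as. g i * coord B i = of_int (y i)"
          using coordsJ[OF \<open>B \<in> J\<close>] by blast
        have "int p dvd x i * y i" using all x(1) y(1) by blast
        then obtain z where z: "x i * y i = int p * z" ..
        have "coord A i * coord B i = of_int (x i) * (g i * coord B i)" using x(2) i by simp
        also have "\<dots> = of_int (x i * y i)" using y(2) i by simp
        finally show "coord A i * coord B i \<in> range (\<lambda>z. of_int (int p * z))"
          unfolding z by (rule range_eqI)
      qed
      then obtain z where "(1 :: rat) = of_int (int p * z)" using i by (auto simp: coord_one)
      then have "int p * z = 1" by linarith
      then show False using p by (auto simp: zmult_eq_1_iff)
    qed
  qed
  then obtain u where u: "u \<in> residue_units"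
    and L: "\<And>x. x \<in> ?L \<longleftrightarrow> (\<exists>r w. interp r \<and> (\<forall>i<length as. x i = u i * r i + vandermonde * w i))"
    by blast
  have k: "elem g \<in> Units K" using g(2) by (simp add: Units_K_iff coord_elem)
  have "I = elem g <#\<^bsub>K\<^esub> class_ideal u"
    unfolding coset_eq_iff[OF k IK class_ideal_sub]
  proof (intro ballI iffI)
    fix Z assume "Z \<in> I"
    then obtain x where x: "x \<in> ?L" "\<forall>i<length as. coord Z i = g i * of_int (x i)"
      using coordsI by blast
    then obtain r w where rw: "interp r" "\<forall>i<length as. x i = u i * r i + vandermonde * w i" using L by blast
    show "elem (\<lambda>i. coord Z i / coord (elem g) i) \<in> class_ideal u"
    proof (rule elem_in_class_ideal[OF rw(1)])
      fix i assume i: "i < length as"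
      have "coord Z i / coord (elem g) i = of_int (x i)" using x(2) g(2) i by (simp add: coord_elem)
      then show "coord Z i / coord (elem g) i = of_int (u i * r i + vandermonde * w i)" using rw(2) i by simp
    qed
  next
    fix Z assume Z: "Z \<in> carrier K" "elem (\<lambda>i. coord Z i / coord (elem g) i) \<in> class_ideal u"
    then obtain r w where rw: "interp r" "\<forall>i<length as.
        coord (elem (\<lambda>i. coord Z i / coord (elem g) i)) i = of_int (u i * r i + vandermonde * w i)"
      unfolding class_ideal_def by blast
    then have "(\<lambda>i. u i * r i + vandermonde * w i) \<in> ?L" unfolding L by blast
    then obtain Y where Y: "Y \<in> I" "\<forall>i<length as. coord Y i = g i * of_int (u i * r i + vandermonde * w i)"
      by blast
    have "Z = Y"
    proof (rule coord_eqI)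
      fix i assume i: "i < length as"
      have "coord Z i / g i = of_int (u i * r i + vandermonde * w i)" using rw(2) i by (simp add: coord_elem)
      then have "coord Z i = g i * of_int (u i * r i + vandermonde * w i)" using g(2)[OF i] by (simp add: field_simps)
      then show "coord Z i = coord Y i" using Y(2) i by simp
    qed (use Z Y IK in auto)
    with Y show "Z \<in> I" by simp
  qed
  then have "(I, class_ideal u) \<in> ideal_equiv as"
    unfolding ideal_equiv_def using k I fractional_class_ideal[of u] by blast
  with u show ?thesis by blast
qed

lemma Cl_eq: "Cl as = (\<lambda>u. ideal_equiv as `` {class_ideal u}) ` residue_units"
proof
  show "Cl as \<subseteq> (\<lambda>u. ideal_equiv as `` {class_ideal u}) ` residue_units"
  proof
    fix C assume "C \<in> Cl as"
    then obtain I where C: "C \<in> {I. fractional_ideal as I} // ideal_equiv as" "I \<in> C" "invertible_ideal as I"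
      unfolding Cl_def ICM_def by blast
    then obtain I0 where I0: "C = ideal_equiv as `` {I0}" by (auto elim: quotientE)
    obtain u where u: "u \<in> residue_units" "(I, class_ideal u) \<in> ideal_equiv as"
      using invertible_ideal_equiv_class_ideal[OF C(3)] by blast
    have "(I0, I) \<in> ideal_equiv as" using C(2) I0 by simp
    then have "(I0, class_ideal u) \<in> ideal_equiv as"
      using u(2) equiv_ideal_equiv by (meson equivE transD)
    then have "C = ideal_equiv as `` {class_ideal u}"
      unfolding I0 using equiv_class_eq[OF equiv_ideal_equiv] by blast
    with u(1) show "C \<in> (\<lambda>u. ideal_equiv as `` {class_ideal u}) ` residue_units" by blast
  qed
  show "(\<lambda>u. ideal_equiv as `` {class_ideal u}) ` residue_units \<subseteq> Cl as"
  proof safe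
    fix u assume u: "u \<in> residue_units"
    have "ideal_equiv as `` {class_ideal u} \<in> ICM as"
      unfolding ICM_def by (rule quotientI) (simp add: fractional_class_ideal)
    moreover have "class_ideal u \<in> ideal_equiv as `` {class_ideal u}"
      by (rule equiv_class_self[OF equiv_ideal_equiv]) (simp add: fractional_class_ideal)
    ultimately show "ideal_equiv as `` {class_ideal u} \<in> Cl as"
      unfolding Cl_def using invertible_class_ideal[OF u] by blast
  qed
qed

lemma finite_Cl: "finite (Cl as)"
  unfolding Cl_eq by (rule finite_imageI) (rule finite_residue_units)

text \<open>The map that sends \<open>u\<close> to the class of \<open>uR + \<Delta>\<int>\<^sup>n\<close> is surjective onto the class group, and all its
  fibres have the cardinality computed in \<open>card_associated\<close>.\<close>

lemma card_Cl:
  assumes wide: "as ! (length as - 1) - as ! 0 > 4" and n: "length as > 0" and vandermonde: "vandermonde > 1"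
  shows "card (Cl as) * (card units_box * 2 ^ (length as - 1)) = totient (nat vandermonde) ^ length as"
proof -
  let ?F = "\<lambda>u. ideal_equiv as `` {class_ideal u}"
  have fibre: "card {u\<in>residue_units. ?F u = C} = card units_box * 2 ^ (length as - 1)" if C: "C \<in> Cl as" for C
  proof -
    obtain v where v: "v \<in> residue_units" "C = ?F v" using C unfolding Cl_eq by blast
    have "?F u = ?F v \<longleftrightarrow> associated u v" if "u \<in> residue_units" for u
      using eq_equiv_class_iff[OF equiv_ideal_equiv, of "class_ideal u" "class_ideal v"]
        class_ideal_equiv_iff[OF that v(1)] by (simp add: fractional_class_ideal)
    then have "{u\<in>residue_units. ?F u = C} = {u\<in>residue_units. associated u v}" unfolding v(2) by blast
    then show ?thesis using card_associated[OF wide n v(1)] by simp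
  qed
  have "card residue_units = (\<Sum>u\<in>residue_units. 1)" by simp
  also have "\<dots> = (\<Sum>C\<in>?F ` residue_units. \<Sum>u\<in>{u\<in>residue_units. ?F u = C}. 1)"
    by (rule sum.image_gen[OF finite_residue_units])
  also have "\<dots> = (\<Sum>C\<in>Cl as. card {u\<in>residue_units. ?F u = C})" by (simp add: Cl_eq)
  also have "\<dots> = (\<Sum>C\<in>Cl as. card units_box * 2 ^ (length as - 1))"
    by (rule sum.cong[OF refl]) (rule fibre)
  finally show ?thesis using card_residue_units[OF vandermonde] by simp
qed

text \<open>A prime divisor of the Vandermonde product divides the difference of two nodes.\<close>

lemma residues_count_le:
  assumes p: "p \<in> prime_factors (nat vandermonde)" shows "residues_count p \<le> length as - 1"
proof -
  let ?f = "\<lambda>i. as ! i mod int p"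
  have "prime p" using p by auto
  moreover have "int p dvd int (nat vandermonde)" using p by (simp only: int_dvd_int_iff) auto
  then have "int p dvd vandermonde" using vandermonde_pos by simp
  ultimately have "prime p" "int p dvd vandermonde" .
  then obtain z where z: "z \<in> {(i, j). i < j \<and> j < length as}" "int p dvd (case z of (i, j) \<Rightarrow> as ! j - as ! i)"
    using finite_pairs unfolding vandermonde_def by (auto simp: prime_dvd_prod_iff)
  then obtain i j where ij: "i < j" "j < length as" "int p dvd as ! j - as ! i" by auto
  have "?f ` {..<length as} \<subseteq> ?f ` ({..<length as} - {j})"
  proof safe
    fix k assume k: "k < length as"
    have "?f j = ?f i" using ij(3) by (simp add: mod_eq_dvd_iff)
    then show "?f k \<in> ?f ` ({..<length as} - {j})" using k ij by (cases "k = j") auto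
  qed
  then have "residues_count p \<le> card (?f ` ({..<length as} - {j}))"
    unfolding residues_count_def by (intro card_mono) auto
  also have "\<dots> \<le> card ({..<length as} - {j})" by (rule card_image_le) simp
  also have "\<dots> = length as - 1" using ij by simp
  finally show ?thesis .
qed

text \<open>The exponent \<open>n - 1 - r(p)\<close> arises from \<open>n\<close> factors of \<open>\<phi>(\<Delta>)\<^sup>n\<close>, the denominator \<open>\<phi>(\<Delta>)\<close>, and the
  units of \<open>R/\<Delta>\<int>\<^sup>n\<close>; by \<open>residues_count_le\<close> the subtraction is not truncated.\<close>

theorem class_ratio_eq:
  assumes n: "length as \<ge> 2" and large: "Delta as > 4 ^ (length as * length as)"
  shows "class_ratio as = ereal (\<Prod>p\<in>prime_factors (nat (Delta as)).
    (1 - 1 / real p) ^ (length as - 1 - residues_count p))"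
proof -
  let ?n = "length as"
  let ?P = "prime_factors (nat vandermonde)"
  have DD: "Delta as = vandermonde" by (simp add: Delta_def vandermonde_def)
  have wide: "as ! (?n - 1) - as ! 0 > 4" using wide_if_vandermonde_large large DD by simp
  have "(1 :: int) \<le> 4 ^ (?n * ?n)" by simp
  then have vandermonde: "vandermonde > 1" using large DD by linarith
  define \<phi> where "\<phi> = real (totient (nat vandermonde))"
  define E where "E = (\<Prod>p\<in>?P. (1 - 1 / real p) ^ residues_count p)"
  have pos: "1 - 1 / real p > 0" if "p \<in> ?P" for p
  proof -
    have "prime p" using that by auto
    then have "p > 1" by (rule prime_gt_1_nat)
    then have "real p > 1" by simp
    then show ?thesis by simp
  qed
  have \<phi>: "\<phi> = real_of_int vandermonde * (\<Prod>p\<in>?P. 1 - 1 / real p)" "\<phi> > 0"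
    using vandermonde by (simp add: \<phi>_def totient_formula2) (use vandermonde in \<open>simp add: \<phi>_def\<close>)
  have E: "E > 0" unfolding E_def by (intro prod_pos zero_less_power pos)
  have "real (card (box ?n)) = real_of_int vandermonde ^ (?n - 1)"
    using card_box_n n by (metis of_int_of_nat_eq of_int_power zero_less_numeral less_le_trans)
  then have H: "real (card units_box) = real_of_int vandermonde ^ (?n - 1) * E"
    by (simp add: card_units_box E_def)
  have "real (card (Cl as)) * (real (card units_box) * 2 ^ (?n - 1)) = \<phi> ^ ?n"
  proof -
    have "length as > 0" using n by linarith
    from arg_cong[OF card_Cl[OF wide this vandermonde], of real] show ?thesis by (simp add: \<phi>_def)
  qed
  then have "real (card (Cl as)) * 2 ^ (?n - 1) * (real_of_int vandermonde ^ (?n - 1) * E) = \<phi> ^ ?n"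
    unfolding H by (simp only: mult_ac)
  moreover have "real_of_int vandermonde ^ (?n - 1) * E \<noteq> 0" using E vandermonde by simp
  ultimately have "real (card (Cl as)) * 2 ^ (?n - 1) = \<phi> ^ ?n / (real_of_int vandermonde ^ (?n - 1) * E)"
    by (intro eq_divide_imp)
  also have "\<phi> ^ ?n = \<phi> * \<phi> ^ (?n - 1)"
  proof -
    have "Suc (?n - 1) = ?n" using n by linarith
    from power_Suc[of \<phi> "?n - 1", unfolded this] show ?thesis .
  qed
  also have "\<phi> ^ (?n - 1) = real_of_int vandermonde ^ (?n - 1) * (\<Prod>p\<in>?P. (1 - 1 / real p) ^ (?n - 1))"
    unfolding \<phi>(1) by (simp add: power_mult_distrib prod_power_distrib)
  also have "(\<Prod>p\<in>?P. (1 - 1 / real p) ^ (?n - 1)) = E * (\<Prod>p\<in>?P. (1 - 1 / real p) ^ (?n - 1 - residues_count p))"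
    unfolding E_def prod.distrib[symmetric]
    by (rule prod.cong) (simp_all only: power_add[symmetric] le_add_diff_inverse residues_count_le)
  finally have "real (card (Cl as)) * 2 ^ (?n - 1) / \<phi> = (\<Prod>p\<in>?P. (1 - 1 / real p) ^ (?n - 1 - residues_count p))"
    using \<phi>(2) E vandermonde by simp
  moreover have "class_ratio as = ereal (real (card (Cl as)) * 2 ^ (?n - 1) / \<phi>)"
    using finite_Cl \<phi>(2) by (simp add: class_ratio_def class_number_def DD \<phi>_def numeral_eq_ereal)
  ultimately show ?thesis by (simp add: DD)
qed

end

section \<open>Extremal tuples of nodes\<close>

definition sup_constant :: "nat \<Rightarrow> real" where
  "sup_constant n = (\<Prod>p | prime p \<and> p \<le> n - 2. (1 - 1 / real p) ^ (n - 1 - p))"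

lemma euler_factor_bounds:
  assumes "prime (p :: nat)" shows "0 < 1 - 1 / real p" "1 - 1 / real p \<le> 1"
  using prime_gt_1_nat[OF assms] by auto

context node_list
begin

lemma difference_dvd_vandermonde:
  assumes "i < j" "j < length as" shows "as ! j - as ! i dvd vandermonde"
  unfolding vandermonde_def
  using dvd_prodI[OF finite_pairs, of "(i, j)" "length as" "\<lambda>(i, j). as ! j - as ! i"] assms by simp

lemma difference_le_vandermonde:
  assumes "i < j" "j < length as" shows "as ! j - as ! i \<le> vandermonde"
  using difference_dvd_vandermonde[OF assms] vandermonde_pos by (rule zdvd_imp_le)

lemma residues_count_le_modulus:
  assumes "p > 0" shows "residues_count p \<le> p"
proof -
  have "residues_count p \<le> card {0..<int p}"
    unfolding residues_count_def by (rule card_mono) (use assms in auto)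
  then show ?thesis by simp
qed

text \<open>By the pigeonhole principle, two of the nodes are congruent modulo \<open>p\<close>.\<close>

lemma small_prime_dvd_vandermonde:
  assumes p: "prime p" "p < length as" shows "p \<in> prime_factors (nat vandermonde)"
proof -
  have "\<not> inj_on (\<lambda>i. as ! i mod int p) {..<length as}"
  proof
    assume "inj_on (\<lambda>i. as ! i mod int p) {..<length as}"
    then have "residues_count p = length as" unfolding residues_count_def by (simp add: card_image)
    then show False using residues_count_le_modulus[of p] prime_gt_0_nat[OF p(1)] p(2) by simp
  qed
  then obtain i j where ij: "i < length as" "j < length as" "i \<noteq> j" "as ! i mod int p = as ! j mod int p"
    unfolding inj_on_def by blast
  have "\<exists>i j. i < j \<and> j < length as \<and> as ! i mod int p = as ! j mod int p"
    using ij by (cases "i < j") (metis, metis linorder_neqE_nat)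
  then obtain i j where ij: "i < j" "j < length as" "as ! i mod int p = as ! j mod int p" by blast
  have "int p dvd as ! j - as ! i" using ij(3) by (simp add: mod_eq_dvd_iff dvd_diff_commute)
  also have "\<dots> dvd vandermonde" using ij(1,2) by (rule difference_dvd_vandermonde)
  finally have "int p dvd int (nat vandermonde)" using vandermonde_pos by simp
  then have "p dvd nat vandermonde" by (simp only: int_dvd_int_iff)
  then show ?thesis using p(1) vandermonde_pos by (simp add: in_prime_factors_iff)
qed

text \<open>Omitting primes and lowering exponents only increases a product of factors between \<open>0\<close> and \<open>1\<close>.\<close>

lemma euler_product_le:
  assumes S: "S \<subseteq> prime_factors (nat vandermonde)"
    and exponent: "\<And>p. p \<in> S \<Longrightarrow> e p \<le> length as - 1 - residues_count p"
  shows "(\<Prod>p\<in>prime_factors (nat vandermonde). (1 - 1 / real p) ^ (length as - 1 - residues_count p))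
    \<le> (\<Prod>p\<in>S. (1 - 1 / real p) ^ e p)"
proof -
  let ?P = "prime_factors (nat vandermonde)"
  let ?f = "\<lambda>p. (1 - 1 / real p) ^ (length as - 1 - residues_count p)"
  have b: "0 < 1 - 1 / real p" "1 - 1 / real p \<le> 1" if "p \<in> ?P" for p
    using euler_factor_bounds[of p] that by auto
  have "prod ?f ?P = prod ?f S * prod ?f (?P - S)"
    using prod.subset_diff[OF S, of ?f] by (simp add: mult.commute)
  also have "\<dots> \<le> prod ?f S * 1"
  proof (rule mult_left_mono)
    show "prod ?f (?P - S) \<le> 1"
    proof (rule prod_le_1)
      fix p assume "p \<in> ?P - S"
      then have "0 < 1 - 1 / real p" "1 - 1 / real p \<le> 1" using b by blast+
      then show "0 \<le> ?f p \<and> ?f p \<le> 1" by (intro conjI power_le_one zero_le_power) (erule less_imp_le)+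
    qed
    show "prod ?f S \<ge> 0"
      by (intro prod_nonneg ballI zero_le_power less_imp_le[OF b(1)] subsetD[OF S])
  qed
  also have "prod ?f S \<le> (\<Prod>p\<in>S. (1 - 1 / real p) ^ e p)"
  proof (rule prod_mono)
    fix p assume p: "p \<in> S"
    then have "p \<in> ?P" using S by blast
    note * = less_imp_le[OF b(1)[OF this]] b(2)[OF this]
    show "0 \<le> ?f p \<and> ?f p \<le> (1 - 1 / real p) ^ e p"
      by (intro conjI power_decreasing zero_le_power * exponent[OF p])
  qed
  finally show ?thesis by simp
qed

lemma Delta_eq_vandermonde: "Delta as = vandermonde"
  by (simp add: Delta_def vandermonde_def)

lemma class_ratio_nonneg:
  assumes n: "length as \<ge> 2" and large: "Delta as > 4 ^ (length as * length as)"
  shows "class_ratio as \<ge> 0"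
  unfolding class_ratio_eq[OF n large]
  by (auto intro!: prod_nonneg zero_le_power less_imp_le[OF euler_factor_bounds(1)])

lemma class_ratio_le:
  assumes n: "length as \<ge> 2" and large: "Delta as > 4 ^ (length as * length as)"
  shows "class_ratio as \<le> ereal (sup_constant (length as))"
proof -
  let ?Q = "{p. prime p \<and> p \<le> length as - 2}"
  have "(\<Prod>p\<in>prime_factors (nat vandermonde). (1 - 1 / real p) ^ (length as - 1 - residues_count p))
    \<le> (\<Prod>p\<in>?Q. (1 - 1 / real p) ^ (length as - 1 - p))"
  proof (rule euler_product_le)
    show "?Q \<subseteq> prime_factors (nat vandermonde)" using n small_prime_dvd_vandermonde by auto
    fix p assume "p \<in> ?Q"
    then have "p > 0" by (simp add: prime_gt_0_nat)
    then show "length as - 1 - p \<le> length as - 1 - residues_count p"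
      using residues_count_le_modulus[of p] by linarith
  qed
  then show ?thesis by (simp add: class_ratio_eq[OF n large] sup_constant_def Delta_eq_vandermonde)
qed

text \<open>The hypothesis \<open>many\<close> forces the smallest possible exponents: \<open>n - 1 - p\<close> for \<open>p \<le> n - 2\<close>, and \<open>0\<close>
  for all larger primes.\<close>

lemma class_ratio_eq_sup_constant:
  assumes n: "length as \<ge> 2" and large: "Delta as > 4 ^ (length as * length as)"
    and many: "\<And>p. p \<in> prime_factors (nat vandermonde) \<Longrightarrow> residues_count p \<ge> min p (length as - 1)"
  shows "class_ratio as = ereal (sup_constant (length as))"
proof -
  let ?P = "prime_factors (nat vandermonde)"
  let ?Q = "{p. prime p \<and> p \<le> length as - 2}"
  have Q: "?Q \<subseteq> ?P" using n small_prime_dvd_vandermonde by auto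
  have "(\<Prod>p\<in>?Q. (1 - 1 / real p) ^ (length as - 1 - p))
      = (\<Prod>p\<in>?P. (1 - 1 / real p) ^ (length as - 1 - residues_count p))"
  proof (rule prod.mono_neutral_cong_left[OF _ Q])
    show "\<forall>p\<in>?P - ?Q. (1 - 1 / real p) ^ (length as - 1 - residues_count p) = 1"
    proof
      fix p assume p: "p \<in> ?P - ?Q"
      then have "p \<ge> length as - 1" by auto
      then have "length as - 1 - residues_count p = 0" using many[of p] p by auto
      then show "(1 - 1 / real p) ^ (length as - 1 - residues_count p) = 1" by simp
    qed
    fix p assume p: "p \<in> ?Q"
    then have "residues_count p \<ge> p" using many[of p] Q by auto
    moreover have "residues_count p \<le> p"
      using residues_count_le_modulus p by (simp add: prime_gt_0_nat)
    ultimately have "residues_count p = p" by simp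
    then show "(1 - 1 / real p) ^ (length as - 1 - p) = (1 - 1 / real p) ^ (length as - 1 - residues_count p)"
      by simp
  qed simp
  then show ?thesis by (simp add: class_ratio_eq[OF n large] sup_constant_def Delta_eq_vandermonde)
qed

end

lemma power_less_of_nat_le:
  fixes D :: int
  assumes "b ^ k < N" "int N \<le> D" shows "int b ^ k < D"
proof -
  have "int (b ^ k) < int N" using assms(1) by (simp only: of_nat_less_iff)
  then show ?thesis using assms(2) by (simp only: of_nat_power)
qed

text \<open>The nodes \<open>0, 1, ..., n - 2\<close> represent as many residue classes as \<open>n - 1\<close> integers can, for
  every modulus.  The last node \<open>M\<close> is free to make the Vandermonde product large.\<close>

lemma sup_constant_attained:
  assumes n: "n \<ge> 2"
  obtains as where "as \<in> int_tuples n" "Delta as \<ge> int N" "class_ratio as = ereal (sup_constant n)"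
proof -
  \<comment> \<open>Large enough for the tuple to be increasing and for the Vandermonde product to exceed
    both \<open>N\<close> and the bound in \<open>class_ratio_eq\<close>.\<close>
  define M where "M = N + n + 4 ^ (n * n)"
  define as where "as = map int [0..<n - 1] @ [int M]"
  have len: "length as = n" using n by (simp add: as_def)
  have nth: "as ! i = int i" if "i < n - 1" for i using that by (simp add: as_def nth_append)
  have last: "as ! (n - 1) = int M" by (simp add: as_def nth_append)
  have "i < M" if "i < n - 1" for i using that by (simp add: M_def)
  then have "sorted_wrt (<) as" by (auto simp: as_def sorted_wrt_append sorted_wrt_map)
  then interpret node_list as by unfold_locales
  have "as ! (n - 1) - as ! 0 \<le> vandermonde" by (rule difference_le_vandermonde) (use n len in auto)
  then have D: "Delta as \<ge> int M" using nth[of 0] last n by (simp add: Delta_eq_vandermonde)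
  have "M > 4 ^ (n * n)" using n by (simp add: M_def)
  then have large: "Delta as > 4 ^ (length as * length as)"
    using D len using power_less_of_nat_le[of 4 "n * n" M] by simp
  have "class_ratio as = ereal (sup_constant (length as))"
  proof (rule class_ratio_eq_sup_constant[OF _ large])
    fix p
    let ?m = "min p (n - 1)"
    have "card (int ` {..<?m}) \<le> residues_count p"
      unfolding residues_count_def
    proof (rule card_mono)
      show "int ` {..<?m} \<subseteq> (\<lambda>i. as ! i mod int p) ` {..<length as}"
      proof safe
        fix i assume i: "i < ?m"
        then have "int i = as ! i mod int p" using nth[of i] by simp
        then show "int i \<in> (\<lambda>i. as ! i mod int p) ` {..<length as}" using i len by auto
      qed
    qed simp
    then show "min p (length as - 1) \<le> residues_count p" by (simp add: card_image len)
  qed (use n len in simp)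
  moreover have "as \<in> int_tuples n" using sorted len by (simp add: int_tuples_def)
  moreover have "N \<le> M" by (simp add: M_def)
  then have "Delta as \<ge> int N" using D by linarith
  ultimately show thesis using that len by simp
qed

text \<open>The product is \<open>\<phi>(m)/m\<close> for \<open>m = k!\<close>, and it is at most \<open>\<phi>(d)/d\<close> for every divisor \<open>d\<close> of \<open>m\<close>.
  Hence \<open>m = \<Sum>\<phi>(d)\<close>, summed over these divisors, is at least \<open>\<phi>(m)/m\<close> times the sum of the
  divisors, among which are \<open>m, m/2, ..., m/k\<close> with sum \<open>m\<close> times the \<open>k\<close>-th harmonic number.\<close>

lemma totient_fact_le:
  "(\<Prod>p\<in>prime_factors (fact k). 1 - 1 / real p) * harm k \<le> 1"
proof -
  define m :: nat where "m = fact k"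
  define E where "E = (\<lambda>d :: nat. \<Prod>p\<in>prime_factors d. 1 - 1 / real p)"
  have m: "m > 0" by (simp add: m_def)
  have pos: "E d > 0" for d
    unfolding E_def by (rule prod_pos) (rule euler_factor_bounds, auto)
  have mono: "E m \<le> E d" if d: "d dvd m" for d
  proof -
    have sub: "prime_factors d \<subseteq> prime_factors m" using d m by (intro dvd_prime_factors) auto
    have "E m = (\<Prod>p\<in>prime_factors m - prime_factors d. 1 - 1 / real p) * E d"
      unfolding E_def by (rule prod.subset_diff[OF sub]) simp
    also have "\<dots> \<le> 1 * E d"
    proof (intro mult_right_mono prod_le_1 less_imp_le[OF pos])
      fix p assume "p \<in> prime_factors m - prime_factors d"
      then have "prime p" by auto
      from euler_factor_bounds[OF this] show "0 \<le> 1 - 1 / real p \<and> 1 - 1 / real p \<le> 1" by simp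
    qed
    finally show ?thesis by simp
  qed
  have "E m * harm k * real m = E m * (\<Sum>j=1..k. real m / real j)"
    by (simp add: harm_def sum_distrib_right sum_distrib_left divide_inverse mult_ac)
  also have "(\<Sum>j=1..k. real m / real j) = (\<Sum>j=1..k. real (m div j))"
  proof (rule sum.cong)
    fix j assume "j \<in> {1..k}"
    then have "j dvd m" unfolding m_def by (intro dvd_fact) auto
    then show "real m / real j = real (m div j)" by (simp add: real_of_nat_div)
  qed simp
  also have "\<dots> = (\<Sum>d\<in>(\<lambda>j. m div j) ` {1..k}. real d)"
  proof (subst sum.reindex)
    show "inj_on ((div) m) {1..k}"
    proof (rule inj_onI)
      fix i j assume ij: "i \<in> {1..k}" "j \<in> {1..k}" "m div i = m div j"
      then have "i dvd m" "j dvd m" unfolding m_def by (auto intro!: dvd_fact)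
      then have "i * (m div i) = m" "j * (m div j) = m" by simp_all
      then have "i * (m div i) = j * (m div i)" by (simp only: ij(3))
      moreover have "m div i \<noteq> 0" using \<open>i dvd m\<close> m by (auto elim!: dvdE)
      ultimately show "i = j" by simp
    qed
  qed simp
  also have "E m * \<dots> \<le> E m * (\<Sum>d | d dvd m. real d)"
  proof (intro mult_left_mono sum_mono2)
    show "(\<lambda>j. m div j) ` {1..k} \<subseteq> {d. d dvd m}"
    proof safe
      fix j assume "j \<in> {1..k}"
      then have "j dvd m" unfolding m_def by (intro dvd_fact) auto
      then have "m = j * (m div j)" by simp
      then show "m div j dvd m" by (rule dvdI[of m "m div j" j, OF trans[OF _ mult.commute]])
    qed
  qed (use m pos less_imp_le in auto)
  also have "\<dots> = (\<Sum>d | d dvd m. real d * E m)" by (simp add: sum_distrib_left mult.commute)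
  also have "\<dots> \<le> (\<Sum>d | d dvd m. real d * E d)" by (intro sum_mono mult_left_mono mono) auto
  also have "\<dots> = (\<Sum>d | d dvd m. real (totient d))" by (simp add: totient_formula2 E_def)
  also have "\<dots> = 1 * real m" by (simp flip: of_nat_sum add: totient_divisor_sum)
  finally have "E m * harm k \<le> 1" using m by (simp only: mult_le_cancel_right of_nat_0_less_iff if_True simp_thms)
  then show ?thesis by (simp add: E_def m_def)
qed

text \<open>If all nodes are divisible by \<open>k!\<close>, they represent a single residue class modulo each prime
  \<open>p \<le> k\<close>.  As \<open>n \<ge> 3\<close>, the exponent of its Euler factor is at least \<open>1\<close>.\<close>

lemma small_class_ratio:
  assumes n: "n \<ge> 3" and k: "k \<ge> 4 ^ (n * n) + N + 1"
  obtains as where "as \<in> int_tuples n" "Delta as \<ge> int N" "class_ratio as \<le> ereal (1 / harm k)"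
proof -
  define as where "as = map (\<lambda>i. int i * fact k) [0..<n]"
  have len: "length as = n" by (simp add: as_def)
  have nth: "as ! i = int i * fact k" if "i < n" for i using that by (simp add: as_def)
  have "sorted_wrt (<) as" by (auto simp: as_def sorted_wrt_map)
  then interpret node_list as by unfold_locales
  have "as ! 1 - as ! 0 \<le> vandermonde" by (rule difference_le_vandermonde) (use n len in auto)
  then have "fact k \<le> vandermonde" using nth[of 0] nth[of 1] n by simp
  moreover have "int k \<le> fact k" using fact_ge_self[of k] by (metis of_nat_fact of_nat_le_iff)
  moreover have "int (4 ^ (n * n) + N + 1) \<le> int k" using k by (simp only: of_nat_le_iff)
  then have "4 ^ (n * n) + int N + 1 \<le> int k" by simp
  ultimately have D: "Delta as > 4 ^ (n * n) + int N" by (simp add: Delta_eq_vandermonde)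
  then have "Delta as > 4 ^ (n * n)" "Delta as \<ge> int N" by (smt (verit) of_nat_0_le_iff zero_le_power)+
  then have large: "Delta as > 4 ^ (length as * length as)" by (simp add: len)
  have "fact k dvd vandermonde" using difference_dvd_vandermonde[of 0 1] nth[of 0] nth[of 1] n len by simp
  then have "int (fact k) dvd int (nat vandermonde)" using vandermonde_pos by simp
  then have "fact k dvd nat vandermonde" by (simp only: int_dvd_int_iff)
  then have sub: "prime_factors (fact k) \<subseteq> prime_factors (nat vandermonde)"
    using vandermonde_pos by (intro dvd_prime_factors) auto
  have "(\<Prod>p\<in>prime_factors (nat vandermonde). (1 - 1 / real p) ^ (length as - 1 - residues_count p))
    \<le> (\<Prod>p\<in>prime_factors (fact k). (1 - 1 / real p) ^ 1)"
  proof (rule euler_product_le[OF sub])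
    fix p assume "p \<in> prime_factors (fact k :: nat)"
    then have "p dvd fact k" by auto
    then have "int p dvd int (fact k)" by (simp only: int_dvd_int_iff)
    then have "as ! i mod int p = 0" if "i < n" for i using nth[OF that] by simp
    then have "(\<lambda>i. as ! i mod int p) ` {..<length as} \<subseteq> {0}" using len by auto
    then have "residues_count p \<le> card {0 :: int}" unfolding residues_count_def by (intro card_mono) auto
    then show "1 \<le> length as - 1 - residues_count p" using n len by simp
  qed
  also have "\<dots> \<le> 1 / harm k"
    using totient_fact_le[of k] k harm_pos[of k, where 'a = real] by (simp add: field_simps)
  finally have "class_ratio as \<le> ereal (1 / harm k)"
    using class_ratio_eq[OF _ large] n len by (simp add: Delta_eq_vandermonde)
  moreover have "as \<in> int_tuples n" using sorted len by (simp add: int_tuples_def)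
  ultimately show thesis using that \<open>Delta as \<ge> int N\<close> by blast
qed

theorem theorem1p2:
  fixes n :: nat
  assumes "n \<ge> 2"
  shows "((\<lambda>N :: nat. INF as \<in> {as \<in> int_tuples n. Delta as \<ge> int N}. class_ratio as)
            \<longlonglongrightarrow> (if n = 2 then 1 else 0))
       \<and> ((\<lambda>N :: nat. SUP as \<in> {as \<in> int_tuples n. Delta as \<ge> int N}. class_ratio as)
            \<longlonglongrightarrow> ereal (\<Prod>p | prime p \<and> p \<le> n - 2. (1 - 1 / real p) ^ (n - 1 - p)))"
proof -
  let ?T = "\<lambda>N :: nat. {as \<in> int_tuples n. Delta as \<ge> int N}"
  have tuple: "node_list as" "length as = n" "Delta as > 4 ^ (length as * length as)"
    if "as \<in> ?T N" "N > 4 ^ (n * n)" for as N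
  proof -
    show "node_list as" "length as = n" using that(1) by (auto simp: int_tuples_def node_list_def)
    then show "Delta as > 4 ^ (length as * length as)"
      using power_less_of_nat_le[OF that(2), of "Delta as"] that(1) by simp
  qed
  have upper: "class_ratio as \<le> ereal (sup_constant n)" and lower: "0 \<le> class_ratio as"
    if "as \<in> ?T N" "N > 4 ^ (n * n)" for as N
    using node_list.class_ratio_le[OF tuple(1)[OF that]] node_list.class_ratio_nonneg[OF tuple(1)[OF that]]
      tuple[OF that] assms by auto
  have sup: "(SUP as \<in> ?T N. class_ratio as) = ereal (sup_constant n)" if N: "N > 4 ^ (n * n)" for N
  proof (rule antisym)
    show "(SUP as \<in> ?T N. class_ratio as) \<le> ereal (sup_constant n)"
      by (rule SUP_least) (rule upper[OF _ N])
    obtain as where "as \<in> ?T N" "class_ratio as = ereal (sup_constant n)"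
      using sup_constant_attained[OF assms, of N] by blast
    then show "ereal (sup_constant n) \<le> (SUP as \<in> ?T N. class_ratio as)" by (metis SUP_upper)
  qed
  have inf: "(INF as \<in> ?T N. class_ratio as) = (if n = 2 then 1 else 0)" if N: "N > 4 ^ (n * n)" for N
  proof (cases "n = 2")
    case True
    have "sup_constant n = 1" by (simp add: sup_constant_def True)
    have "class_ratio as = 1" if as: "as \<in> ?T N" for as
    proof -
      interpret node_list as by (rule tuple(1)[OF as N])
      have "class_ratio as = ereal (sup_constant (length as))"
      proof (rule class_ratio_eq_sup_constant)
        fix p
        have "residues_count p > 0"
          unfolding residues_count_def using tuple(2)[OF as N] True by (simp add: card_gt_0_iff lessThan_empty_iff)
        then show "min p (length as - 1) \<le> residues_count p" using tuple(2)[OF as N] True by simp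
      qed (use tuple[OF as N] True in auto)
      then show ?thesis using \<open>sup_constant n = 1\<close> tuple(2)[OF as N] by simp
    qed
    moreover have "?T N \<noteq> {}" using sup_constant_attained[OF assms, of N] by blast
    ultimately show ?thesis using True by (simp cong: INF_cong_simp)
  next
    case False
    have "(INF as \<in> ?T N. class_ratio as) \<le> 0"
    proof (rule LIMSEQ_le_const)
      have "(\<lambda>k. inverse (harm k :: real)) \<longlonglongrightarrow> 0"
        by (rule tendsto_inverse_0_at_top[OF harm_at_top])
      then show "(\<lambda>k. ereal (1 / harm k)) \<longlonglongrightarrow> 0"
        by (simp add: zero_ereal_def inverse_eq_divide)
      show "\<exists>k0. \<forall>k\<ge>k0. (INF as \<in> ?T N. class_ratio as) \<le> ereal (1 / harm k)"
      proof (intro exI allI impI)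
        fix k assume "k \<ge> 4 ^ (n * n) + N + 1"
        moreover have "n \<ge> 3" using assms False by simp
        ultimately obtain as where as: "as \<in> ?T N" "class_ratio as \<le> ereal (1 / harm k)"
          using small_class_ratio[of n N k] by blast
        then show "(INF as \<in> ?T N. class_ratio as) \<le> ereal (1 / harm k)" by (intro INF_lower2)
      qed
    qed
    moreover have "(INF as \<in> ?T N. class_ratio as) \<ge> 0"
      by (rule INF_greatest) (rule lower[OF _ N])
    ultimately show ?thesis using False by simp
  qed
  have large: "eventually (\<lambda>N. N > 4 ^ (n * n)) sequentially" by (rule eventually_gt_at_top)
  have "(\<lambda>N. INF as \<in> ?T N. class_ratio as) \<longlonglongrightarrow> (if n = 2 then 1 else 0)"
    by (rule tendsto_eventually) (rule eventually_mono[OF large inf])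
  moreover have "(\<lambda>N. SUP as \<in> ?T N. class_ratio as) \<longlonglongrightarrow> ereal (sup_constant n)"
    by (rule tendsto_eventually) (rule eventually_mono[OF large sup])
  ultimately show ?thesis unfolding sup_constant_def ..
qed

end
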